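(* Let $d\ge2$ and let $\{\omega(\mathbf u):\mathbf u\in\mathbb Z_+^d\}$ be i.i.d. real random variables such that there exists $\xi>0$ with $\mathbb E\big(e^{\xi|\omega(\mathbf 0)|}\big)<\infty$. Let $I$ be the Cramér large deviation rate function of the weights, and assume that $$\alpha_\infty=\lim_{x\nearrow\infty}x^{-1}I(x)<\infty.$$ For $\mathbf u\in\mathbb R_+^d\setminus\{\mathbf 0\}$ and $r\in\mathbb R$ let $J_{\mathbf u}(r)=-\lim_{n\to\infty}n^{-1}\log\mathbb P\{\log Z_{\lfloor n\mathbf u\rfloor}\ge nr\}$, and define $J_{\mathbf 0}(r)=0$ for $r\le0$ and $J_{\mathbf 0}(r)=\alpha_\infty r$ for $r\ge0$. Then $(\mathbf u,r)\mapsto J_{\mathbf u}(r)$ is finite and continuous on $\mathbb R_+^d\times\mathbb R$.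
   Context: $\mathbb Z_+$ and $\mathbb R_+$ denote nonnegative integers and nonnegative reals. $\lfloor\mathbf y\rfloor=(\lfloor y_1\rfloor,\dots,\lfloor y_d\rfloor)$ and $|\mathbf u|_1=|u_1|+\dots+|u_d|$. For $\mathbf u\in\mathbb Z_+^d$, $Z_{\mathbf u}=\sum_{x_\cdot\in\Pi_{\mathbf u}}e^{\sum_{j=1}^{|\mathbf u|_1}\omega(x_j)}$, where $\Pi_{\mathbf u}$ is the set of directed lattice paths $x_0=\mathbf 0,x_1,\dots,x_{|\mathbf u|_1}=\mathbf u$ in $\mathbb Z_+^d$ whose steps are standard basis vectors. The Cramér rate function is $$I(r)=-\lim_{\varepsilon\to0}\lim_{n\to\infty}n^{-1}\log\mathbb P\Big\{n^{-1}\sum_{i=1}^n\omega(\mathbf u_i)\in(r-\varepsilon,r+\varepsilon)\Big\},$$ where $\{\mathbf u_i\}$ are any distinct lattice points. The limit $\alpha_\infty\in[0,\infty]$ exists by convexity of $I$. The assumption $\alpha_\infty<\infty$ implies $\mathbb P\{\omega(\mathbf 0)>r\}>0$ for all $r<\infty$; under these assumptions the limit defining $J_{\mathbf u}(r)$ exists in $[0,\infty)$ for all $\mathbf u\in\mathbb R_+^d\setminus\{\mathbf 0\}$, $r\in\mathbb R$. *)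

theory Defs
  imports "HOL-Probability.Probability"
begin

text \<open>Logarithm of a probability, with \<open>log 0 = -\<infinity>\<close>; the library has \<open>ln 0 = 0\<close>.\<close>

definition elog :: "real \<Rightarrow> ereal" where
  "elog p = (if p \<le> 0 then -\<infinity> else ereal (ln p))"

definition l1 :: "nat ^ 'd \<Rightarrow> nat" where
  "l1 u = (\<Sum>i\<in>UNIV. u $ i)"

text \<open>A path is the list of the points it visits, so it has one more entry than it has steps.\<close>

definition directed_paths :: "nat ^ 'd \<Rightarrow> (nat ^ 'd) list set" where
  "directed_paths u = {x. length x = l1 u + 1 \<and> x ! 0 = 0 \<and> x ! l1 u = u \<and>
     (\<forall>j<l1 u. \<exists>i. x ! (j + 1) = x ! j + axis i 1)}"

definition partition_fun :: "(nat ^ 'd \<Rightarrow> 'w \<Rightarrow> real) \<Rightarrow> nat ^ 'd \<Rightarrow> 'w \<Rightarrow> real" where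
  "partition_fun \<omega> u w = (\<Sum>x\<in>directed_paths u. exp (\<Sum>j=1..l1 u. \<omega> (x ! j) w))"

definition floor_pt :: "real ^ 'd \<Rightarrow> nat ^ 'd" where
  "floor_pt y = (\<chi> i. nat \<lfloor>y $ i\<rfloor>)"

text \<open>The Cramer rate function, computed along a sequence \<open>v 1, v 2, \<dots>\<close> of lattice points. For
  i.i.d. weights it does not depend on the choice of \<open>v\<close> as long as these points are distinct.\<close>

definition cramer_rate ::
    "'w measure \<Rightarrow> (nat ^ 'd \<Rightarrow> 'w \<Rightarrow> real) \<Rightarrow> (nat \<Rightarrow> nat ^ 'd) \<Rightarrow> real \<Rightarrow> ereal" where
  "cramer_rate M \<omega> v r =
     - Lim (at_right 0) (\<lambda>\<epsilon>::real. lim (\<lambda>n.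
         elog (measure M {w \<in> space M. (\<Sum>i=1..n. \<omega> (v i) w) / real n \<in> {r - \<epsilon><..<r + \<epsilon>}})
           / ereal (real n)))"

definition alpha_inf ::
    "'w measure \<Rightarrow> (nat ^ 'd \<Rightarrow> 'w \<Rightarrow> real) \<Rightarrow> (nat \<Rightarrow> nat ^ 'd) \<Rightarrow> ereal" where
  "alpha_inf M \<omega> v = Lim at_top (\<lambda>x::real. cramer_rate M \<omega> v x / ereal x)"

definition tail_exponent ::
    "'w measure \<Rightarrow> (nat ^ 'd \<Rightarrow> 'w \<Rightarrow> real) \<Rightarrow> real ^ 'd \<Rightarrow> real \<Rightarrow> nat \<Rightarrow> ereal" where
  "tail_exponent M \<omega> u r n =
     elog (measure M {w \<in> space M. ln (partition_fun \<omega> (floor_pt (real n *\<^sub>R u)) w) \<ge> real n * r})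
       / ereal (real n)"

text \<open>The argument \<open>\<alpha>\<close> is the constant that fixes the values at the origin.\<close>

definition J_rate ::
    "'w measure \<Rightarrow> (nat ^ 'd \<Rightarrow> 'w \<Rightarrow> real) \<Rightarrow> ereal \<Rightarrow> real ^ 'd \<Rightarrow> real \<Rightarrow> ereal" where
  "J_rate M \<omega> \<alpha> u r =
     (if u = 0 then (if r \<le> 0 then 0 else \<alpha> * ereal r)
      else - lim (tail_exponent M \<omega> u r))"

definition nonneg_orthant :: "(real ^ 'd) set" where
  "nonneg_orthant = {u. \<forall>i. 0 \<le> u $ i}"

end

(* Concatenating independent paths makes -log P(log Z_u >= r) subadditive in (u, r), up to a
   bounded cost for the rounding of points.  This yields J together with its homogeneity and
   convexity, and the bound J_v <= J_u + C |v - u|_1 for u <= v.  The one inequality in the other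
   direction comes from replacing every step in a set B of directions by a step in a fixed
   direction k outside B.  Once the times and directions of the B-steps are prescribed, this map is
   injective on the sites that can be visited, so it preserves the joint law of the weights, and
   log Z_u is controlled by the logarithm of the point-to-point partition function at the image
   of u.  The number of prescriptions is at most t^(-b) (1 + d t)^|u|_1, where b is the number of
   B-steps and 0 < t <= 1 is arbitrary.  Taking for B the coordinates that vanish at u0 gives lower
   semicontinuity at u0, and taking all coordinates but one compares J near the origin with the
   one-dimensional random walk, whose tail rate has asymptotic slope alpha_inf. *)

theory Submission
  imports Defs
begin

section \<open>Lattice paths as words in the unit steps\<close>

text \<open>Appending steps bounds \<open>J\<close> at a point through a smaller point. Near
  \<open>u0\<close> this controls \<open>J\<close> from above, because nearby points eventually
  dominate \<open>(1 - t) u0\<close>. A bound from below would need them to lie under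
  \<open>(1 + t) u0\<close>, which can fail when \<open>u0\<close> is on the boundary of the
  orthant; a finite convex function may jump exactly there, so an estimate special to the model is
  required. The parameter \<open>t\<close> separates two limits: the entropy b log (1/t) + d t |u|
  is made small by fixing a small \<open>t\<close> first and letting b tend to 0 afterwards. At the
  origin b and |u| are comparable, but both tend to 0, so \<open>t = 1\<close> suffices. Finiteness
  of \<open>alpha_inf\<close> acts twice: it makes the weights unbounded above, so that tails at
  nonzero points are positive, and it makes the slope a real number. The exponential moment forces
  the one-dimensional rate to grow; by convexity it is then strictly increasing far out, where the
  two-sided windows of the Cramer function and the one-sided tails have the same rate.\<close>

definition coord_sum :: "'a::comm_monoid_add ^ 'd \<Rightarrow> 'a" where
  "coord_sum u = (\<Sum>i\<in>UNIV. u $ i)"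

text \<open>One polymorphic sum serves lattice points, where it is the time at which a path visits
  the point, and real points, where it is the 1-norm on the orthant.\<close>

lemma l1_eq_coord_sum: "l1 u = coord_sum u"
  by (simp add: l1_def coord_sum_def)

lemma coord_sum_add: "coord_sum (u + v) = coord_sum u + coord_sum v"
  by (simp add: coord_sum_def sum.distrib)

lemma coord_sum_0 [simp]: "coord_sum 0 = 0"
  by (simp add: coord_sum_def)

lemma coord_sum_axis [simp]: "coord_sum (axis i a) = a"
  by (simp add: coord_sum_def axis_def)

lemma coord_sum_eq_0_iff_nat: "coord_sum (u :: nat ^ 'd) = 0 \<longleftrightarrow> u = 0"
  by (simp add: coord_sum_def vec_eq_iff)

text \<open>For \<open>k\<close> outside \<open>B\<close>, this is the additive extension to points
  of the letter map that sends \<open>B\<close> to \<open>k\<close>. The same formula acts on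
  lattice points and on real directions.\<close>

definition collapse :: "'d set \<Rightarrow> 'd \<Rightarrow> 'a::comm_monoid_add ^ 'd \<Rightarrow> 'a ^ 'd" where
  "collapse B k u =
     (\<chi> i. if i \<in> B then 0 else if i = k then u $ k + (\<Sum>j\<in>B. u $ j) else u $ i)"

lemma collapse_0 [simp]: "collapse B k 0 = 0"
  by (simp add: collapse_def vec_eq_iff)

lemma collapse_add: "collapse B k (u + v) = collapse B k u + collapse B k v"
  by (simp add: collapse_def vec_eq_iff sum.distrib add_ac)

lemma collapse_axis:
  fixes i :: "'d::finite"
  assumes "k \<notin> B"
  shows "collapse B k (axis i a) = axis (if i \<in> B then k else i) a"
proof -
  have "(\<Sum>j\<in>B. axis i a $ j) = (if i \<in> B then a else 0)"
    by (simp add: axis_def)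
  then show ?thesis
    using assms by (auto simp: collapse_def vec_eq_iff axis_def)
qed

text \<open>The mass taken from \<open>B\<close> reappears at \<open>k\<close>. Collapsing thus
  preserves the time of a site, which is what allows the lost coordinates to be recovered from a
  skeleton.\<close>

lemma coord_sum_collapse:
  fixes u :: "'a::comm_monoid_add ^ 'd"
  assumes "k \<notin> B"
  shows "coord_sum (collapse B k u) = coord_sum u"
proof -
  have "coord_sum (collapse B k u) = (\<Sum>i\<in>UNIV - B. collapse B k u $ i)"
    unfolding coord_sum_def by (rule sum.mono_neutral_right) (auto simp: collapse_def)
  also have "\<dots> = collapse B k u $ k + (\<Sum>i\<in>UNIV - B - {k}. collapse B k u $ i)"
    using assms by (intro sum.remove) auto
  also have "collapse B k u $ k = u $ k + (\<Sum>j\<in>B. u $ j)"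
    using assms by (simp add: collapse_def)
  also have "(\<Sum>i\<in>UNIV - B - {k}. collapse B k u $ i) = (\<Sum>i\<in>UNIV - B - {k}. u $ i)"
    by (rule sum.cong) (auto simp: collapse_def)
  also have "u $ k + (\<Sum>j\<in>B. u $ j) + (\<Sum>i\<in>UNIV - B - {k}. u $ i)
      = (\<Sum>j\<in>B. u $ j) + (u $ k + (\<Sum>i\<in>UNIV - B - {k}. u $ i))"
    by (simp add: add_ac)
  also have "u $ k + (\<Sum>i\<in>UNIV - B - {k}. u $ i) = (\<Sum>i\<in>UNIV - B. u $ i)"
    using assms by (intro sum.remove[symmetric]) auto
  also have "(\<Sum>j\<in>B. u $ j) + (\<Sum>i\<in>UNIV - B. u $ i) = coord_sum u"
    unfolding coord_sum_def using sum.subset_diff[of B UNIV "\<lambda>i. u $ i"] by (simp add: add_ac)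
  finally show ?thesis .
qed

text \<open>Paths are encoded by their words of step directions: concatenation becomes list append,
  and collapsing becomes a map on letters.\<close>

definition endpoint :: "'d list \<Rightarrow> nat ^ 'd" where
  "endpoint ds = (\<Sum>i\<leftarrow>ds. axis i 1)"

lemma endpoint_Nil [simp]: "endpoint [] = 0"
  and endpoint_Cons [simp]: "endpoint (i # ds) = axis i 1 + endpoint ds"
  and endpoint_append [simp]: "endpoint (ds @ es) = endpoint ds + endpoint es"
  by (simp_all add: endpoint_def)

lemma coord_sum_endpoint: "coord_sum (endpoint ds) = length ds"
  by (induction ds) (auto simp: coord_sum_add)

lemma endpoint_nth: "endpoint ds $ i = count_list ds i"
  by (induction ds) (auto simp: axis_def)

text \<open>The starting point is left out, as its weight does not enter the partition function;
  concatenated paths therefore never count the junction twice.\<close>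

fun sites :: "nat ^ 'd \<Rightarrow> 'd list \<Rightarrow> (nat ^ 'd) list" where
  "sites p [] = []"
| "sites p (i # ds) = (p + axis i 1) # sites (p + axis i 1) ds"

lemma length_sites [simp]: "length (sites p ds) = length ds"
  by (induction ds arbitrary: p) auto

lemma sites_append: "sites p (ds @ es) = sites p ds @ sites (p + endpoint ds) es"
  by (induction ds arbitrary: p) (auto simp: add_ac)

lemma sites_add: "sites (q + p) ds = map ((+) q) (sites p ds)"
  by (induction ds arbitrary: p) (auto simp: add.assoc)

lemma last_sites: "last (p # sites p ds) = p + endpoint ds"
  by (induction ds arbitrary: p) (auto simp: add_ac)

lemma set_sites: "s \<in> set (sites p ds) \<Longrightarrow> \<exists>j\<in>{1..length ds}. s = p + endpoint (take j ds)"
proof (induction ds arbitrary: p)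
  case (Cons i ds)
  show ?case
  proof (cases "s = p + axis i 1")
    case True
    then show ?thesis by (intro bexI[of _ 1]) auto
  next
    case False
    then obtain j where "j \<in> {1..length ds}" "s = p + axis i 1 + endpoint (take j ds)"
      using Cons.IH[of "p + axis i 1"] Cons.prems by auto
    then show ?thesis by (intro bexI[of _ "Suc j"]) (auto simp: add.assoc)
  qed
qed auto

lemma sites_collapse:
  assumes "k \<notin> B"
  shows "sites (collapse B k p) (map (\<lambda>i. if i \<in> B then k else i) ds)
    = map (collapse B k) (sites p ds)"
proof (induction ds arbitrary: p)
  case (Cons i ds)
  have "collapse B k p + axis (if i \<in> B then k else i) 1 = collapse B k (p + axis i 1)"
    by (simp add: collapse_add collapse_axis[OF assms])
  then show ?case using Cons[of "p + axis i 1"] by (simp del: One_nat_def)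
qed simp

lemma endpoint_collapse:
  assumes "k \<notin> B"
  shows "endpoint (map (\<lambda>i. if i \<in> B then k else i) ds) = collapse B k (endpoint ds)"
  by (induction ds) (simp_all add: collapse_add collapse_axis[OF assms])

lemma exists_word: "\<exists>ds. endpoint ds = u"
proof (induction "coord_sum u" arbitrary: u)
  case 0
  then have "u = 0" by (simp add: coord_sum_eq_0_iff_nat)
  then show ?case by (intro exI[of _ "[]"]) simp
next
  case (Suc n)
  then have "u \<noteq> 0" by auto
  then obtain i where i: "u $ i \<noteq> 0" by (auto simp: vec_eq_iff)
  define v where "v = (\<chi> j. if j = i then u $ i - 1 else u $ j)"
  have uv: "u = axis i 1 + v" using i by (auto simp: v_def vec_eq_iff axis_def)
  with Suc have "n = coord_sum v" by (simp add: coord_sum_add)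
  with Suc(1) obtain ds where "endpoint ds = v" by blast
  with uv show ?case by (intro exI[of _ "i # ds"]) simp
qed

definition words :: "nat ^ 'd \<Rightarrow> 'd list set" where
  "words u = {ds. endpoint ds = u}"

lemma words_length: "ds \<in> words u \<Longrightarrow> length ds = coord_sum u"
  using coord_sum_endpoint[of ds] by (simp add: words_def)

lemma finite_words [simp]: "finite (words (u :: nat ^ 'd))"
proof (rule finite_subset)
  show "words u \<subseteq> {ds. set ds \<subseteq> UNIV \<and> length ds = coord_sum u}"
    using words_length by auto
qed (rule finite_lists_length_eq, simp)

lemma words_nonempty [simp]: "words u \<noteq> {}"
  using exists_word[of u] by (auto simp: words_def)

lemma path_is_sites:
  assumes "length x = Suc n" "\<forall>j<n. \<exists>i. x ! (j + 1) = x ! j + axis i 1"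
  shows "\<exists>ds. x = x ! 0 # sites (x ! 0) ds"
  using assms
proof (induction n arbitrary: x)
  case 0
  then show ?case by (intro exI[of _ "[]"]) (auto simp: length_Suc_conv)
next
  case (Suc n)
  then obtain p y where x: "x = p # y" and y: "length y = Suc n" by (auto simp: length_Suc_conv)
  have "\<forall>j<n. \<exists>i. y ! (j + 1) = y ! j + axis i 1"
    using Suc(3) x by force
  from Suc(1)[OF y this] obtain ds where ds: "y = y ! 0 # sites (y ! 0) ds" by blast
  from Suc(3) x obtain i where "y ! 0 = p + axis i 1" by force
  with x ds show ?case by (intro exI[of _ "i # ds"]) auto
qed

lemma sites_steps:
  "j < length ds \<Longrightarrow> (p # sites p ds) ! (j + 1) = (p # sites p ds) ! j + axis (ds ! j) 1"
proof (induction ds arbitrary: p j)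
  case (Cons i ds)
  then show ?case by (cases j) auto
qed auto

lemma directed_paths_eq: "directed_paths u = (\<lambda>ds. 0 # sites 0 ds) ` words u"
proof (intro equalityI subsetI)
  fix x assume "x \<in> directed_paths u"
  then have x: "length x = Suc (l1 u)" "x ! 0 = 0" "x ! l1 u = u"
      "\<forall>j<l1 u. \<exists>i. x ! (j + 1) = x ! j + axis i 1"
    by (auto simp: directed_paths_def)
  from path_is_sites[OF x(1,4)] x(2) obtain ds where ds: "x = 0 # sites 0 ds" by auto
  have "last x = u" using x(1,3) by (metis diff_Suc_1 last_conv_nth length_0_conv nat.distinct(1))
  then have "ds \<in> words u" using last_sites[of 0 ds] ds by (simp add: words_def)
  then show "x \<in> (\<lambda>ds. 0 # sites 0 ds) ` words u" using ds by blast
next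
  fix x assume "x \<in> (\<lambda>ds. 0 # sites 0 ds) ` words u"
  then obtain ds where ds: "ds \<in> words u" "x = 0 # sites 0 ds" by blast
  have len: "length ds = l1 u" using words_length[OF ds(1)] by (simp add: l1_eq_coord_sum)
  have "last x = u" using last_sites[of 0 ds] ds by (simp add: words_def)
  then have "x ! l1 u = u" using ds(2) len last_conv_nth[of x] by simp
  moreover have "\<forall>j<l1 u. \<exists>i. x ! (j + 1) = x ! j + axis i 1"
    using sites_steps[of _ ds 0] ds(2) len by auto
  ultimately show "x \<in> directed_paths u" using ds(2) len by (auto simp: directed_paths_def)
qed

section \<open>Sums of exponential weights over lists of sites\<close>

definition site_lists :: "nat ^ 'd \<Rightarrow> (nat ^ 'd) list set" where
  "site_lists u = sites 0 ` words u"

lemma finite_site_lists [simp]: "finite (site_lists u)"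
  by (simp add: site_lists_def)

lemma site_lists_nonempty [simp]: "site_lists u \<noteq> {}"
  by (simp add: site_lists_def)

text \<open>Arbitrary sets of site lists are allowed because partial partition functions occur: one
  skeleton class, shifted paths, or a single straight path.\<close>

definition gibbs_sum :: "('s \<Rightarrow> 'w \<Rightarrow> real) \<Rightarrow> 's list set \<Rightarrow> 'w \<Rightarrow> real" where
  "gibbs_sum \<omega> A w = (\<Sum>l\<in>A. exp (\<Sum>s\<leftarrow>l. \<omega> s w))"

lemma partition_fun_eq: "partition_fun \<omega> u w = gibbs_sum \<omega> (site_lists u) w"
proof -
  have "partition_fun \<omega> u w = (\<Sum>x\<in>Cons 0 ` site_lists u. exp (\<Sum>j=1..l1 u. \<omega> (x ! j) w))"
    unfolding partition_fun_def directed_paths_eq site_lists_def image_image ..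
  also have "\<dots> = (\<Sum>l\<in>site_lists u. exp (\<Sum>j=1..l1 u. \<omega> ((0 # l) ! j) w))"
    by (subst sum.reindex) auto
  also have "\<dots> = gibbs_sum \<omega> (site_lists u) w"
    unfolding gibbs_sum_def
  proof (rule sum.cong[OF refl])
    fix l assume "l \<in> site_lists u"
    then have len: "length l = l1 u"
      by (auto simp: site_lists_def words_length l1_eq_coord_sum)
    have "(\<Sum>j=1..l1 u. \<omega> ((0 # l) ! j) w) = (\<Sum>j<l1 u. \<omega> (l ! j) w)"
      by (rule sum.reindex_bij_witness[of _ Suc "\<lambda>j. j - 1"]) auto
    also have "\<dots> = (\<Sum>s\<leftarrow>l. \<omega> s w)"
      by (simp add: sum_list_sum_nth len atLeast0LessThan)
    finally show "exp (\<Sum>j=1..l1 u. \<omega> ((0 # l) ! j) w) = exp (\<Sum>s\<leftarrow>l. \<omega> s w)" by simp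
  qed
  finally show ?thesis .
qed

lemma gibbs_sum_pos: "finite A \<Longrightarrow> A \<noteq> {} \<Longrightarrow> gibbs_sum \<omega> A w > 0"
  by (simp add: gibbs_sum_def sum_pos)

lemma gibbs_sum_nonneg: "gibbs_sum \<omega> A w \<ge> 0"
  by (simp add: gibbs_sum_def sum_nonneg)

lemma gibbs_sum_mono: "finite B \<Longrightarrow> A \<subseteq> B \<Longrightarrow> gibbs_sum \<omega> A w \<le> gibbs_sum \<omega> B w"
  unfolding gibbs_sum_def by (rule sum_mono2) auto

lemma gibbs_sum_UN_le:
  assumes "finite I" "\<And>i. i \<in> I \<Longrightarrow> finite (A i)"
  shows "gibbs_sum \<omega> (\<Union>i\<in>I. A i) w \<le> (\<Sum>i\<in>I. gibbs_sum \<omega> (A i) w)"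
  using assms
proof (induction I)
  case (insert i I)
  have "gibbs_sum \<omega> (A i \<union> (\<Union>j\<in>I. A j)) w + gibbs_sum \<omega> (A i \<inter> (\<Union>j\<in>I. A j)) w
      = gibbs_sum \<omega> (A i) w + gibbs_sum \<omega> (\<Union>j\<in>I. A j) w"
    unfolding gibbs_sum_def using insert by (intro sum.union_inter) auto
  moreover have "gibbs_sum \<omega> (A i \<inter> (\<Union>j\<in>I. A j)) w \<ge> 0" by (rule gibbs_sum_nonneg)
  ultimately show ?case using insert by simp
qed (simp add: gibbs_sum_def)

text \<open>An injection on the visited sites keeps distinct lists distinct, so no summands
  merge.\<close>

lemma gibbs_sum_reindex:
  assumes "inj_on \<phi> S" "A \<subseteq> lists S"
  shows "gibbs_sum \<omega> (map \<phi> ` A) w = gibbs_sum (\<lambda>s. \<omega> (\<phi> s)) A w"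
proof -
  have "inj_on (map \<phi>) A"
    using assms by (meson inj_on_mapI inj_on_subset inj_on_map_lists)
  then show ?thesis unfolding gibbs_sum_def by (simp add: sum.reindex comp_def)
qed

text \<open>Equal lengths in \<open>A\<close> make the cut of a concatenation unique, so the double
  sum has no repeated terms and factorizes.\<close>

lemma gibbs_sum_append:
  assumes "\<And>l. l \<in> A \<Longrightarrow> length l = n"
  shows "gibbs_sum \<omega> ((\<lambda>(l, l'). l @ l') ` (A \<times> B)) w = gibbs_sum \<omega> A w * gibbs_sum \<omega> B w"
proof -
  have "inj_on (\<lambda>(l, l'). l @ l') (A \<times> B)"
    using assms by (auto simp: inj_on_def)
  then show ?thesis
    unfolding gibbs_sum_def
    by (subst sum.reindex) (simp_all add: sum_product sum.cartesian_product exp_add case_prod_beta)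
qed

text \<open>A point on a coordinate axis is reached by a single path, so its partition function is
  the exponential of a random walk. This is the link to the Cramer rate.\<close>

lemma site_lists_axis: "site_lists (axis i n) = {map (axis i) [1..<Suc n]}"
proof -
  have 1: "words (axis i n) = {replicate n i}"
  proof (intro equalityI subsetI)
    fix ds assume ds: "ds \<in> words (axis i n)"
    then have len: "length ds = n" by (simp add: words_length)
    have "j = i" if "j \<in> set ds" for j
    proof (rule ccontr)
      assume "j \<noteq> i"
      then have "count_list ds j = 0"
        using ds endpoint_nth[of ds j] by (simp add: words_def axis_def)
      then show False using that by (simp add: count_list_0_iff)
    qed
    then show "ds \<in> {replicate n i}" using len by (simp add: replicate_eqI)
  next
    fix ds assume "ds \<in> {replicate n i}"
    moreover have "endpoint (replicate n i) = axis i n"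
      by (induction n) (auto simp: axis_def vec_eq_iff)
    ultimately show "ds \<in> words (axis i n)" by (simp add: words_def)
  qed
  have "sites (axis i m) (replicate n i) = map (axis i) [Suc m..<Suc (m + n)]" for m
  proof (induction n arbitrary: m)
    case (Suc n)
    have "axis i m + axis i 1 = axis i (Suc m)" by (simp add: axis_def vec_eq_iff)
    then show ?case using Suc[of "Suc m"] by (simp add: upt_rec del: upt_Suc)
  qed simp
  from this[of 0] show ?thesis by (simp add: site_lists_def 1 axis_def[of i "0::nat"] zero_vec_def)
qed

text \<open>The strict lower bound comes from omitting the starting point; after a shift by
  \<open>u\<close> it places the sites of a second path at times beyond
  \<open>coord_sum u\<close>.\<close>

lemma set_site_lists:
  assumes "l \<in> site_lists u" "s \<in> set l"
  shows "0 < coord_sum s" "coord_sum s \<le> coord_sum u"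
proof -
  obtain ds where ds: "ds \<in> words u" "l = sites 0 ds" using assms by (auto simp: site_lists_def)
  obtain j where "j \<in> {1..length ds}" "s = endpoint (take j ds)"
    using set_sites assms(2) ds(2) by fastforce
  then show "0 < coord_sum s" "coord_sum s \<le> coord_sum u"
    using words_length[OF ds(1)] by (auto simp: coord_sum_endpoint)
qed

lemma site_lists_concat:
  "(\<lambda>(l, l'). l @ l') ` (site_lists u \<times> map ((+) u) ` site_lists v) \<subseteq> site_lists (u + v)"
proof clarsimp
  fix l l' assume "l \<in> site_lists u" "l' \<in> site_lists v"
  then obtain ds es where "ds \<in> words u" "es \<in> words v" "l = sites 0 ds" "l' = sites 0 es"
    by (auto simp: site_lists_def)
  then have "ds @ es \<in> words (u + v)" "l @ map ((+) u) l' = sites 0 (ds @ es)"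
    using sites_add[of u 0 es] by (auto simp: words_def sites_append)
  then show "l @ map ((+) u) l' \<in> site_lists (u + v)" by (auto simp: site_lists_def)
qed

section \<open>Counting the prescriptions of the steps in \<open>B\<close>\<close>

definition skeleton :: "'d set \<Rightarrow> 'd list \<Rightarrow> 'd option list" where
  "skeleton B = map (\<lambda>i. if i \<in> B then Some i else None)"

lemma count_skeleton: "i \<in> B \<Longrightarrow> count_list (skeleton B ds) (Some i) = count_list ds i"
  by (induction ds) (auto simp: skeleton_def)

lemma sum_prod_list:
  fixes f :: "'a::finite \<Rightarrow> real"
  shows "(\<Sum>xs | length xs = n. \<Prod>x\<leftarrow>xs. f x) = (\<Sum>x\<in>UNIV. f x) ^ n"
proof (induction n)
  case (Suc n)
  have "{xs::'a list. length xs = Suc n} = (\<lambda>(x, xs). x # xs) ` (UNIV \<times> {xs. length xs = n})"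
    by (auto simp: length_Suc_conv image_iff)
  moreover have "inj_on (\<lambda>(x, xs). x # xs) (UNIV \<times> {xs::'a list. length xs = n})"
    by (auto simp: inj_on_def)
  ultimately have "(\<Sum>xs | length xs = Suc n. \<Prod>x\<leftarrow>xs. f x)
      = (\<Sum>(x, xs)\<in>UNIV \<times> {xs. length xs = n}. f x * (\<Prod>x\<leftarrow>xs. f x))"
    by (simp only: sum.reindex) (simp add: case_prod_beta)
  also have "\<dots> = (\<Sum>x\<in>UNIV. f x) * (\<Sum>xs | length xs = n. \<Prod>x\<leftarrow>xs. f x)"
    by (simp add: sum_product sum.cartesian_product)
  finally show ?case using Suc by simp
qed auto

text \<open>Give each letter \<open>Some i\<close> weight \<open>t\<close> and the letter
  \<open>None\<close>, a step whose direction outside \<open>B\<close> is left free, weight 1. All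
  skeletons of words for \<open>u\<close> then have the same weight, while the total weight of all
  lists of that length factorizes over the positions. Counting every direction instead of those in
  \<open>B\<close> keeps the bound uniform in \<open>B\<close>.\<close>

lemma card_skeletons:
  fixes u :: "nat ^ 'd"
  assumes t: "0 < t" "t \<le> 1"
  shows "real (card (skeleton B ` words u)) * t ^ (\<Sum>i\<in>B. u $ i)
    \<le> (1 + real CARD('d) * t) ^ coord_sum u"
proof -
  define f :: "'d option \<Rightarrow> real" where "f = (\<lambda>x. if x = None then 1 else t)"
  have prod: "(\<Prod>x\<leftarrow>skeleton B ds. f x) = t ^ (\<Sum>i\<in>B. endpoint ds $ i)" for ds :: "'d list"
  proof (induction ds)
    case (Cons i ds)
    have "(\<Sum>j\<in>B. axis i (1::nat) $ j) = (if i \<in> B then 1 else 0)" by (simp add: axis_def)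
    then show ?case using Cons by (simp add: skeleton_def f_def sum.distrib)
  qed (simp add: skeleton_def)
  have "real (card (skeleton B ` words u)) * t ^ (\<Sum>i\<in>B. u $ i)
      = (\<Sum>xs\<in>skeleton B ` words u. \<Prod>x\<leftarrow>xs. f x)"
  proof -
    have "(\<Prod>x\<leftarrow>xs. f x) = t ^ (\<Sum>i\<in>B. u $ i)" if "xs \<in> skeleton B ` words u" for xs
      using that prod by (auto simp: words_def)
    then show ?thesis by simp
  qed
  also have "\<dots> \<le> (\<Sum>xs | length xs = coord_sum u. \<Prod>x\<leftarrow>xs. f x)"
  proof (rule sum_mono2)
    show "finite {xs :: 'd option list. length xs = coord_sum u}"
      using finite_lists_length_eq[of "UNIV :: 'd option set" "coord_sum u"] by simp
    show "skeleton B ` words u \<subseteq> {xs. length xs = coord_sum u}"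
      by (auto simp: skeleton_def words_length)
    show "0 \<le> (\<Prod>x\<leftarrow>xs. f x)" for xs
      by (rule prod_list_nonneg) (use t in \<open>auto simp: f_def\<close>)
  qed
  also have "\<dots> = (1 + real CARD('d) * t) ^ coord_sum u"
    unfolding sum_prod_list by (simp add: UNIV_option_conv sum.reindex f_def)
  finally show ?thesis .
qed

text \<open>The \<open>B\<close>-coordinates of a path at time n are the letter counts in the first
  n entries of its skeleton, so this set contains every site that a path with skeleton
  \<open>\<sigma>\<close> can visit.\<close>

definition skeleton_sites :: "'d set \<Rightarrow> 'd option list \<Rightarrow> (nat ^ 'd) set" where
  "skeleton_sites B \<sigma> = {p. \<forall>i\<in>B. p $ i = count_list (take (coord_sum p) \<sigma>) (Some i)}"

text \<open>The skeleton and the time \<open>coord_sum p\<close> determine the coordinates in \<open>B\<close>, so collapsing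
  them forgets nothing.\<close>

lemma inj_on_collapse:
  assumes "k \<notin> B"
  shows "inj_on (collapse B k) (skeleton_sites B \<sigma>)"
proof (rule inj_onI)
  fix p q assume p: "p \<in> skeleton_sites B \<sigma>" and q: "q \<in> skeleton_sites B \<sigma>"
    and eq: "collapse B k p = collapse B k q"
  have tot: "coord_sum p = coord_sum q" using coord_sum_collapse[OF assms] eq by metis
  have B: "p $ i = q $ i" if "i \<in> B" for i
    using p q that tot by (simp add: skeleton_sites_def)
  have sB: "(\<Sum>i\<in>B. p $ i) = (\<Sum>i\<in>B. q $ i)" using B by (rule sum.cong[OF refl])
  have eqi: "collapse B k p $ i = collapse B k q $ i" for i using eq by simp
  show "p = q"
  proof (simp add: vec_eq_iff, rule allI)
    fix i show "p $ i = q $ i"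
      using B[of i] eqi[of i] sB assms
      by (cases "i \<in> B"; cases "i = k") (auto simp: collapse_def)
  qed
qed

lemma sites_in_skeleton_sites:
  "set (sites 0 ds) \<subseteq> skeleton_sites B (skeleton B ds)"
proof
  fix s assume "s \<in> set (sites 0 ds)"
  then obtain j where j: "j \<in> {1..length ds}" "s = endpoint (take j ds)"
    using set_sites by fastforce
  then have "coord_sum s = j" by (simp add: coord_sum_endpoint)
  moreover have "take j (skeleton B ds) = skeleton B (take j ds)"
    by (simp add: skeleton_def take_map)
  ultimately show "s \<in> skeleton_sites B (skeleton B ds)"
    using j by (auto simp: skeleton_sites_def count_skeleton endpoint_nth)
qed

section \<open>Independence and collapsing of directions\<close>

lemma (in prob_space) indep_vars_reindex:
  assumes "indep_vars (\<lambda>_. N) X (\<phi> ` S)" "inj_on \<phi> S"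
  shows "indep_vars (\<lambda>_. N) (\<lambda>s. X (\<phi> s)) S"
proof -
  have rv: "X (\<phi> s) \<in> measurable M N" if "s \<in> S" for s
    using assms(1) that by (auto simp: indep_vars_def)
  have ind: "indep_sets (\<lambda>i. {X i -` A \<inter> space M | A. A \<in> sets N}) (\<phi> ` S)"
    using assms(1) by (simp add: indep_vars_def2)
  have "indep_sets (\<lambda>s. {X (\<phi> s) -` A \<inter> space M | A. A \<in> sets N}) S"
  proof (rule indep_setsI)
    show "{X (\<phi> s) -` A \<inter> space M | A. A \<in> sets N} \<subseteq> events" if "s \<in> S" for s
      using rv[OF that] by (auto intro: measurable_sets)
    fix A J assume J: "J \<noteq> {}" "J \<subseteq> S" "finite J"
      "\<forall>j\<in>J. A j \<in> {X (\<phi> j) -` A \<inter> space M | A. A \<in> sets N}"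
    have inj: "inj_on \<phi> J" using assms(2) J(2) by (rule inj_on_subset)
    define A' where "A' i = A (inv_into J \<phi> i)" for i
    have A': "A' (\<phi> j) = A j" if "j \<in> J" for j
      using that inj by (simp add: A'_def)
    have "prob (\<Inter>i\<in>\<phi> ` J. A' i) = (\<Prod>i\<in>\<phi> ` J. prob (A' i))"
      by (rule indep_setsD[OF ind]) (use J A' in auto)
    moreover have "(\<Inter>i\<in>\<phi> ` J. A' i) = (\<Inter>j\<in>J. A j)"
      using A' by (intro equalityI subsetI) auto
    moreover have "(\<Prod>i\<in>\<phi> ` J. prob (A' i)) = (\<Prod>j\<in>J. prob (A j))"
      using A' by (simp add: prod.reindex[OF inj])
    ultimately show "prob (\<Inter>j\<in>J. A j) = (\<Prod>j\<in>J. prob (A j))" by simp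
  qed
  then show ?thesis using rv by (simp add: indep_vars_def2)
qed

text \<open>Evaluation at the coordinate maps of the product space exhibits a path sum as a function
  of the weights on \<open>S\<close> alone; its law and its independence from other sums can then be
  read off from joint laws.\<close>

lemma borel_measurable_gibbs_sum:
  assumes "A \<subseteq> lists S"
  shows "(\<lambda>f. gibbs_sum (\<lambda>s f. f s) A f) \<in> borel_measurable (PiM S (\<lambda>_. borel))"
proof -
  have "(\<lambda>f. \<Sum>s\<leftarrow>l. f s) \<in> borel_measurable (PiM S (\<lambda>_. borel :: real measure))"
    if "l \<in> lists S" for l
    using that
  proof (induction l)
    case (Cons s l)
    then have [measurable]: "s \<in> S"
      "(\<lambda>f. \<Sum>s\<leftarrow>l. f s) \<in> borel_measurable (PiM S (\<lambda>_. borel :: real measure))"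
      by auto
    show ?case by simp
  qed simp
  then show ?thesis
    unfolding gibbs_sum_def using assms
    by (intro borel_measurable_sum borel_measurable_exp[THEN measurable_compose_rev]) auto
qed

lemma gibbs_sum_restrict:
  assumes "A \<subseteq> lists S"
  shows "gibbs_sum (\<lambda>s f. f s) A (\<lambda>s\<in>S. \<omega> s w) = gibbs_sum \<omega> A w"
proof -
  have "map (\<lambda>s. (\<lambda>s\<in>S. \<omega> s w) s) l = map (\<lambda>s. \<omega> s w) l" if "l \<in> A" for l
    using that assms by (auto simp: in_lists_conv_set)
  then show ?thesis unfolding gibbs_sum_def by (intro sum.cong arg_cong[where f = exp]) metis+
qed

locale iid_weights = prob_space M for M :: "'w measure" +
  fixes \<omega> :: "nat ^ 'd \<Rightarrow> 'w \<Rightarrow> real"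
  assumes indep: "indep_vars (\<lambda>_. borel) \<omega> UNIV"
    and ident: "\<And>u. distr M borel (\<omega> u) = distr M borel (\<omega> 0)"
begin

lemma rv [measurable]: "\<omega> u \<in> borel_measurable M"
  using indep by (simp add: indep_vars_def)

lemma gibbs_sum_measurable [measurable]: "gibbs_sum \<omega> A \<in> borel_measurable M"
proof -
  have "(\<lambda>w. \<Sum>s\<leftarrow>l. \<omega> s w) \<in> borel_measurable M" for l
    by (induction l) auto
  then show ?thesis unfolding gibbs_sum_def by measurable
qed

text \<open>Both sides are product measures with the same marginals.\<close>

lemma joint_law_eq:
  assumes "inj_on \<phi> S"
  shows "distr M (PiM S (\<lambda>_. borel)) (\<lambda>w. \<lambda>s\<in>S. \<omega> s w)
    = distr M (PiM S (\<lambda>_. borel)) (\<lambda>w. \<lambda>s\<in>S. \<omega> (\<phi> s) w)"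
proof (cases "S = {}")
  case False
  have 1: "indep_vars (\<lambda>_. borel) \<omega> S" "indep_vars (\<lambda>_. borel) \<omega> (\<phi> ` S)"
    by (rule indep_vars_subset[OF indep]; simp)+
  have "distr M (PiM S (\<lambda>_. borel)) (\<lambda>w. \<lambda>s\<in>S. \<omega> s w) = PiM S (\<lambda>s. distr M borel (\<omega> s))"
    using indep_vars_iff_distr_eq_PiM'[OF False, where M' = "\<lambda>_. borel" and X = \<omega>] 1 by auto
  also have "\<dots> = PiM S (\<lambda>s. distr M borel (\<omega> (\<phi> s)))"
    using ident by (intro PiM_cong) metis+
  also have "\<dots> = distr M (PiM S (\<lambda>_. borel)) (\<lambda>w. \<lambda>s\<in>S. \<omega> (\<phi> s) w)"
    using indep_vars_iff_distr_eq_PiM'[OF False, where M' = "\<lambda>_. borel" and X = "\<lambda>s. \<omega> (\<phi> s)"]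
      indep_vars_reindex[OF 1(2) assms] by auto
  finally show ?thesis .
qed (simp add: restrict_def)

text \<open>Moving the sites injectively does not change the joint law of their weights. This one
  principle yields translation invariance, the freedom to choose the points of a walk, and the
  comparison under collapsing.\<close>

lemma gibbs_sum_law:
  assumes inj: "inj_on \<phi> S" and A: "A \<subseteq> lists S" and X: "X \<in> sets borel"
  shows "prob {w \<in> space M. gibbs_sum \<omega> A w \<in> X} = prob {w \<in> space M. gibbs_sum \<omega> (map \<phi> ` A) w \<in> X}"
proof -
  let ?N = "PiM S (\<lambda>_. borel :: real measure)" and ?G = "\<lambda>f. gibbs_sum (\<lambda>s f. f s) A f"
  have [measurable]: "?G \<in> borel_measurable ?N"
    by (rule borel_measurable_gibbs_sum[OF A])
  note [measurable] = X
  have *: "prob {w \<in> space M. gibbs_sum Y A w \<in> X}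
      = measure (distr M ?N (\<lambda>w. \<lambda>s\<in>S. Y s w)) {f \<in> space ?N. ?G f \<in> X}"
    if [measurable]: "\<And>s. Y s \<in> borel_measurable M" for Y
  proof (subst measure_distr)
    show "(\<lambda>w. \<lambda>s\<in>S. Y s w) \<in> M \<rightarrow>\<^sub>M ?N" by measurable
    show "{f \<in> space ?N. ?G f \<in> X} \<in> sets ?N" by measurable
  qed (auto intro!: arg_cong[where f = prob] simp: gibbs_sum_restrict[OF A] space_PiM)
  show ?thesis
    unfolding gibbs_sum_reindex[OF inj A] by (simp add: * joint_law_eq[OF inj])
qed

lemma gibbs_sum_indep:
  assumes "A \<subseteq> lists S" "B \<subseteq> lists T" "S \<inter> T = {}" and X: "X \<in> sets borel" "Y \<in> sets borel"
  shows "prob {w \<in> space M. gibbs_sum \<omega> A w \<in> X \<and> gibbs_sum \<omega> B w \<in> Y}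
    = prob {w \<in> space M. gibbs_sum \<omega> A w \<in> X} * prob {w \<in> space M. gibbs_sum \<omega> B w \<in> Y}"
proof -
  have "indep_var (PiM S (\<lambda>_. borel)) (\<lambda>w. \<lambda>s\<in>S. \<omega> s w) (PiM T (\<lambda>_. borel)) (\<lambda>w. \<lambda>s\<in>T. \<omega> s w)"
    using indep_var_restrict[OF indep assms(3)] by simp
  from indep_var_compose[OF this borel_measurable_gibbs_sum[OF assms(1)] borel_measurable_gibbs_sum[OF assms(2)]]
  have "indep_var borel (gibbs_sum \<omega> A) borel (gibbs_sum \<omega> B)"
    using gibbs_sum_restrict[OF assms(1), of \<omega>] gibbs_sum_restrict[OF assms(2), of \<omega>]
    by (simp add: comp_def)
  from indep_varD[OF this X] show ?thesis
    by (simp add: vimage_def Int_def conj_commute)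
qed

section \<open>Tail probabilities of the logarithm of the partition function\<close>

definition tail :: "nat ^ 'd \<Rightarrow> real \<Rightarrow> real" where
  "tail u r = prob {w \<in> space M. ln (partition_fun \<omega> u w) \<ge> r}"

lemma tail_eq: "tail u r = prob {w \<in> space M. gibbs_sum \<omega> (site_lists u) w \<in> {exp r..}}"
proof -
  have "r \<le> ln (gibbs_sum \<omega> (site_lists u) w) \<longleftrightarrow> exp r \<le> gibbs_sum \<omega> (site_lists u) w" for w
    by (rule ln_ge_iff[OF gibbs_sum_pos[OF finite_site_lists site_lists_nonempty]])
  then show ?thesis by (simp add: tail_def partition_fun_eq)
qed

lemma tail_nonneg: "tail u r \<ge> 0" and tail_le_1: "tail u r \<le> 1"
  by (simp_all add: tail_def)

lemma tail_antimono: "r \<le> s \<Longrightarrow> tail u s \<le> tail u r"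
  unfolding tail_eq by (intro finite_measure_mono) (auto intro: order_trans[of "exp r" "exp s"])

text \<open>Paths through \<open>u\<close> contribute a product of two path sums. Their sites lie at
  times up to \<open>coord_sum u\<close> and after it, so the factors are independent.\<close>

lemma tail_superadditive: "tail u r * tail v s \<le> tail (u + v) (r + s)"
proof -
  let ?S = "{p :: nat ^ 'd. coord_sum p \<le> coord_sum u}" and ?T = "{p :: nat ^ 'd. coord_sum p > coord_sum u}"
  let ?V = "map ((+) u) ` site_lists v"
  have S: "site_lists u \<subseteq> lists ?S" using set_site_lists by (fastforce simp: in_lists_conv_set)
  have T: "?V \<subseteq> lists ?T" using set_site_lists by (fastforce simp: in_lists_conv_set coord_sum_add)
  have len: "length l = coord_sum u" if "l \<in> site_lists u" for l
    using that by (auto simp: site_lists_def words_length)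
  have "tail v s = prob {w \<in> space M. gibbs_sum \<omega> ?V w \<in> {exp s..}}"
    unfolding tail_eq by (rule gibbs_sum_law[where S = UNIV]) auto
  then have "tail u r * tail v s = prob {w \<in> space M. gibbs_sum \<omega> (site_lists u) w \<in> {exp r..}
      \<and> gibbs_sum \<omega> ?V w \<in> {exp s..}}"
    unfolding tail_eq[of u r] by (subst gibbs_sum_indep[OF S T]) auto
  also have "\<dots> \<le> tail (u + v) (r + s)"
    unfolding tail_eq
  proof (rule finite_measure_mono, safe)
    fix w assume "gibbs_sum \<omega> (site_lists u) w \<ge> exp r" "gibbs_sum \<omega> ?V w \<ge> exp s"
    then have "exp (r + s) \<le> gibbs_sum \<omega> (site_lists u) w * gibbs_sum \<omega> ?V w"
      unfolding exp_add by (intro mult_mono gibbs_sum_nonneg) auto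
    also have "\<dots> = gibbs_sum \<omega> ((\<lambda>(l, l'). l @ l') ` (site_lists u \<times> ?V)) w"
      using len by (rule gibbs_sum_append[symmetric])
    also have "\<dots> \<le> gibbs_sum \<omega> (site_lists (u + v)) w"
      by (rule gibbs_sum_mono[OF finite_site_lists site_lists_concat])
    finally show "exp (r + s) \<le> gibbs_sum \<omega> (site_lists (u + v)) w" .
  qed measurable
  finally show ?thesis .
qed

text \<open>Split the paths by skeleton into \<open>N\<close> classes. If the whole sum reaches
  \<open>exp r\<close>, some class reaches \<open>exp r / N\<close>, and collapsing turns the law of
  that class into that of a sum over some paths to the collapsed point. Thus
  \<open>ln N \<le> D u\<close> is paid twice: in the level by the pigeonhole step and in the
  prefactor by the union bound.\<close>

lemma tail_collapse:
  assumes k: "k \<notin> B" and t: "0 < t" "t \<le> 1"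
  defines "D \<equiv> \<lambda>u. real (\<Sum>i\<in>B. u $ i) * ln (1 / t) + real (coord_sum u) * (real CARD('d) * t)"
  shows "tail u r \<le> exp (D u) * tail (collapse B k u) (r - D u)"
proof -
  define \<Sigma> where "\<Sigma> = skeleton B ` words u"
  define N where "N = real (card \<Sigma>)"
  have fin: "finite \<Sigma>" by (simp add: \<Sigma>_def)
  have N: "N > 0" using fin by (simp add: N_def \<Sigma>_def card_gt_0_iff)
  have "N * t ^ (\<Sum>i\<in>B. u $ i) \<le> (1 + real CARD('d) * t) ^ coord_sum u"
    unfolding N_def \<Sigma>_def by (rule card_skeletons[OF t])
  also have "\<dots> \<le> exp (real CARD('d) * t) ^ coord_sum u"
    using t by (intro power_mono exp_ge_add_one_self) auto
  also have "\<dots> = exp (real (coord_sum u) * (real CARD('d) * t))"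
    by (simp add: exp_of_nat_mult)
  finally have "ln (N * t ^ (\<Sum>i\<in>B. u $ i)) \<le> ln (exp (real (coord_sum u) * (real CARD('d) * t)))"
    using N t by (intro ln_mono) auto
  then have lnN: "ln N \<le> D u"
    using N t by (simp add: D_def ln_mult ln_realpow ln_div)
  define A where "A \<sigma> = sites 0 ` {ds \<in> words u. skeleton B ds = \<sigma>}" for \<sigma>
  have A: "A \<sigma> \<subseteq> lists (skeleton_sites B \<sigma>)" for \<sigma>
    using sites_in_skeleton_sites by (fastforce simp: A_def in_lists_conv_set)
  have img: "map (collapse B k) ` A \<sigma> \<subseteq> site_lists (collapse B k u)" for \<sigma>
  proof
    fix l assume "l \<in> map (collapse B k) ` A \<sigma>"
    then obtain ds where ds: "ds \<in> words u" "l = map (collapse B k) (sites 0 ds)"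
      by (auto simp: A_def)
    then have "map (\<lambda>i. if i \<in> B then k else i) ds \<in> words (collapse B k u)"
      "l = sites 0 (map (\<lambda>i. if i \<in> B then k else i) ds)"
      using sites_collapse[OF k, of 0 ds] endpoint_collapse[OF k, of ds]
      by (auto simp: words_def)
    then show "l \<in> site_lists (collapse B k u)" by (auto simp: site_lists_def)
  qed
  have piece: "prob {w \<in> space M. gibbs_sum \<omega> (A \<sigma>) w \<in> {exp (r - ln N)..}}
      \<le> tail (collapse B k u) (r - ln N)" for \<sigma>
  proof -
    have "prob {w \<in> space M. gibbs_sum \<omega> (A \<sigma>) w \<in> {exp (r - ln N)..}}
        = prob {w \<in> space M. gibbs_sum \<omega> (map (collapse B k) ` A \<sigma>) w \<in> {exp (r - ln N)..}}"
      by (rule gibbs_sum_law[OF inj_on_collapse[OF k] A]) simp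
    also have "\<dots> \<le> tail (collapse B k u) (r - ln N)"
      unfolding tail_eq
      by (intro finite_measure_mono)
        (auto intro: order_trans[OF _ gibbs_sum_mono[OF finite_site_lists img]])
    finally show ?thesis .
  qed
  have "site_lists u = (\<Union>\<sigma>\<in>\<Sigma>. A \<sigma>)" by (auto simp: site_lists_def A_def \<Sigma>_def)
  then have sum: "gibbs_sum \<omega> (site_lists u) w \<le> (\<Sum>\<sigma>\<in>\<Sigma>. gibbs_sum \<omega> (A \<sigma>) w)" for w
    using gibbs_sum_UN_le[OF fin, of A \<omega> w] by (simp add: A_def)
  have "tail u r \<le> prob (\<Union>\<sigma>\<in>\<Sigma>. {w \<in> space M. gibbs_sum \<omega> (A \<sigma>) w \<in> {exp (r - ln N)..}})"
    unfolding tail_eq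
  proof (rule finite_measure_mono)
    show "{w \<in> space M. gibbs_sum \<omega> (site_lists u) w \<in> {exp r..}}
      \<subseteq> (\<Union>\<sigma>\<in>\<Sigma>. {w \<in> space M. gibbs_sum \<omega> (A \<sigma>) w \<in> {exp (r - ln N)..}})"
    proof clarsimp
      fix w assume w: "w \<in> space M" "exp r \<le> gibbs_sum \<omega> (site_lists u) w"
      show "\<exists>\<sigma>\<in>\<Sigma>. exp (r - ln N) \<le> gibbs_sum \<omega> (A \<sigma>) w"
      proof (rule ccontr)
        assume "\<not> ?thesis"
        then have "(\<Sum>\<sigma>\<in>\<Sigma>. gibbs_sum \<omega> (A \<sigma>) w) < (\<Sum>\<sigma>\<in>\<Sigma>. exp (r - ln N))"
          using fin N by (intro sum_strict_mono) (auto simp: N_def not_le)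
        also have "\<dots> = exp r" using N by (simp add: exp_diff N_def)
        finally show False using w sum[of w] by simp
      qed
    qed
    show "(\<Union>\<sigma>\<in>\<Sigma>. {w \<in> space M. gibbs_sum \<omega> (A \<sigma>) w \<in> {exp (r - ln N)..}}) \<in> events"
      using fin by (intro sets.finite_UN) auto
  qed
  also have "\<dots> \<le> (\<Sum>\<sigma>\<in>\<Sigma>. prob {w \<in> space M. gibbs_sum \<omega> (A \<sigma>) w \<in> {exp (r - ln N)..}})"
    using fin by (intro finite_measure_subadditive_finite) auto
  also have "\<dots> \<le> (\<Sum>\<sigma>\<in>\<Sigma>. tail (collapse B k u) (r - ln N))"
    by (intro sum_mono piece)
  also have "\<dots> = exp (ln N) * tail (collapse B k u) (r - ln N)"
    using N by (simp add: N_def)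
  also have "\<dots> \<le> exp (D u) * tail (collapse B k u) (r - D u)"
    using lnN by (intro mult_mono tail_antimono tail_nonneg) auto
  finally show ?thesis .
qed

end

section \<open>The tail rate function\<close>

text \<open>Fekete's lemma for a real parameter. Adding \<open>\<bar>C\<bar>\<close> absorbs the
  error and makes the function exactly subadditive; local boundedness controls the remainder after
  division by \<open>s\<close>, which here ranges over an interval.\<close>

lemma fekete_at_top:
  fixes f :: "real \<Rightarrow> real"
  assumes a: "a > 0" and nonneg: "\<And>t. t \<ge> a \<Longrightarrow> f t \<ge> 0"
    and sub: "\<And>s t. s \<ge> a \<Longrightarrow> t \<ge> a \<Longrightarrow> f (s + t) \<le> f s + f t + C"
    and bdd: "\<And>b. \<exists>K. \<forall>t\<in>{a..b}. f t \<le> K"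
  shows "\<exists>l. ((\<lambda>t. f t / t) \<longlongrightarrow> l) at_top"
proof -
  define h where "h t = f t + \<bar>C\<bar>" for t
  have h0: "h t \<ge> 0" if "t \<ge> a" for t using nonneg[OF that] by (simp add: h_def)
  have hs: "h (s + t) \<le> h s + h t" if "s \<ge> a" "t \<ge> a" for s t
    using sub[OF that] by (simp add: h_def)
  have hn: "h (real n * s + t) \<le> real n * h s + h t" if "s \<ge> a" "t \<ge> a" for s t n
  proof (induction n)
    case (Suc n)
    have "h (real (Suc n) * s + t) = h (s + (real n * s + t))" by (simp add: algebra_simps)
    also have "\<dots> \<le> h s + h (real n * s + t)"
      by (rule hs) (use that a in \<open>auto intro: add_increasing\<close>)
    finally show ?case using Suc by (simp add: algebra_simps)
  qed simp
  define l where "l = Inf ((\<lambda>t. h t / t) ` {a..})"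
  have bb: "bdd_below ((\<lambda>t. h t / t) ` {a..})"
    using h0 a by (intro bdd_belowI[of _ 0]) auto
  have "((\<lambda>t. h t / t) \<longlongrightarrow> l) at_top"
  proof (rule order_tendstoI)
    fix e assume "e < l"
    then have "e < h t / t" if "t \<ge> a" for t
      using cInf_lower[OF _ bb, of "h t / t"] that by (auto simp: l_def)
    then show "\<forall>\<^sub>F t in at_top. e < h t / t"
      by (auto simp: eventually_at_top_linorder)
  next
    fix e assume e: "l < e"
    then obtain s where s: "s \<ge> a" "h s / s < e"
      using cInf_less_iff[OF _ bb, of e] by (auto simp: l_def)
    obtain K0 where "\<forall>t\<in>{a..2 * s}. f t \<le> K0" using bdd by blast
    then have K: "h t \<le> K0 + \<bar>C\<bar>" if "t \<in> {a..2 * s}" for t using that by (auto simp: h_def)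
    define K where "K = K0 + \<bar>C\<bar>"
    have up: "h t / t \<le> h s / s + K / t" if t: "t \<ge> s" for t
    proof -
      have s0: "s > 0" using s a by simp
      \<comment> \<open>One less than the full quotient, so that the remainder
        \<open>t - real n * s\<close> lies in the interval from \<open>s\<close> to
        \<open>2 * s\<close> and never drops below \<open>a\<close>.\<close>
      define n where "n = nat (\<lfloor>t / s\<rfloor> - 1)"
      have "t / s \<ge> 1" using t s0 by simp
      then have "\<lfloor>t / s\<rfloor> \<ge> 1" by simp
      then have n: "real n = of_int \<lfloor>t / s\<rfloor> - 1" by (simp add: n_def)
      have "of_int \<lfloor>t / s\<rfloor> \<le> t / s" "t / s < of_int \<lfloor>t / s\<rfloor> + 1" by linarith+
      then have "(real n + 1) * s \<le> t / s * s" "t / s * s < (real n + 2) * s"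
        using s0 by (auto simp only: n intro!: mult_right_mono mult_strict_right_mono)
      then have b: "(real n + 1) * s \<le> t" "t < (real n + 2) * s"
        using s0 by simp_all
      have "h t = h (real n * s + (t - real n * s))" by simp
      also have "\<dots> \<le> real n * h s + h (t - real n * s)"
        using b s by (intro hn) (auto simp: algebra_simps)
      also have "\<dots> \<le> real n * h s + K"
        unfolding K_def using b s by (intro add_left_mono K) (auto simp: algebra_simps)
      also have "\<dots> \<le> (t / s) * h s + K"
        using b s0 h0[OF s(1)] by (intro add_right_mono mult_right_mono) (auto simp: field_simps)
      finally have "h t / t \<le> ((t / s) * h s + K) / t"
        using t s0 by (intro divide_right_mono) auto
      then show ?thesis using t s0 by (simp add: field_simps)
    qed
    have "((\<lambda>t. h s / s + K / t) \<longlongrightarrow> h s / s + 0) at_top"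
      by (intro tendsto_intros tendsto_divide_0[OF tendsto_const] filterlim_at_top_imp_at_infinity
          filterlim_ident)
    then have "\<forall>\<^sub>F t in at_top. h s / s + K / t < e"
      by (rule order_tendstoD(2)) (use s in simp)
    then show "\<forall>\<^sub>F t in at_top. h t / t < e"
      using eventually_ge_at_top[of s] by eventually_elim (use up in force)
  qed
  moreover have "((\<lambda>t. \<bar>C\<bar> / t) \<longlongrightarrow> 0) at_top"
    by (intro tendsto_divide_0[OF tendsto_const] filterlim_at_top_imp_at_infinity filterlim_ident)
  ultimately have "((\<lambda>t. h t / t - \<bar>C\<bar> / t) \<longlongrightarrow> l - 0) at_top"
    by (rule tendsto_diff)
  then have "((\<lambda>t. f t / t) \<longlongrightarrow> l) at_top"
    by (simp add: h_def diff_divide_distrib[symmetric])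
  then show ?thesis by blast
qed

section \<open>Rounding of real points to the lattice\<close>

lemma nonneg_orthant_iff: "u \<in> nonneg_orthant \<longleftrightarrow> 0 \<le> u"
  by (simp add: nonneg_orthant_def less_eq_vec_def)

lemma coord_sum_floor_pt:
  fixes x :: "real ^ 'd"
  assumes "0 \<le> x"
  shows "real (coord_sum (floor_pt x)) \<le> coord_sum x"
    and "coord_sum x - real CARD('d) \<le> real (coord_sum (floor_pt x))"
proof -
  have x: "0 \<le> x $ i" for i using assms by (simp add: less_eq_vec_def)
  have *: "x $ i - 1 \<le> real (floor_pt x $ i)" "real (floor_pt x $ i) \<le> x $ i" for i
    using x[of i] unfolding floor_pt_def by (simp; linarith)+
  show "real (coord_sum (floor_pt x)) \<le> coord_sum x"
    unfolding coord_sum_def of_nat_sum using * by (intro sum_mono)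
  have "(\<Sum>i\<in>UNIV. x $ i - 1) \<le> (\<Sum>i\<in>UNIV. real (floor_pt x $ i))"
    using * by (intro sum_mono)
  then show "coord_sum x - real CARD('d) \<le> real (coord_sum (floor_pt x))"
    by (simp add: coord_sum_def sum_subtractf)
qed

lemma floor_pt_mono: "x \<le> y \<Longrightarrow> floor_pt x \<le> floor_pt y"
  by (auto simp: floor_pt_def less_eq_vec_def intro!: nat_mono floor_mono)

text \<open>Rounding errors have the favourable sign: only missing steps have to be appended, and
  their number is bounded by the dimension.\<close>

lemma floor_pt_add_le:
  assumes "0 \<le> x" "0 \<le> y"
  shows "floor_pt x + floor_pt y \<le> floor_pt (x + y)"
proof -
  have "nat \<lfloor>x $ i\<rfloor> + nat \<lfloor>y $ i\<rfloor> \<le> nat \<lfloor>x $ i + y $ i\<rfloor>" for i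
  proof -
    have "0 \<le> x $ i" "0 \<le> y $ i" using assms by (simp_all add: less_eq_vec_def)
    then have "nat \<lfloor>x $ i\<rfloor> + nat \<lfloor>y $ i\<rfloor> = nat (\<lfloor>x $ i\<rfloor> + \<lfloor>y $ i\<rfloor>)" by (simp add: nat_add_distrib)
    also have "\<dots> \<le> nat \<lfloor>x $ i + y $ i\<rfloor>" by (intro nat_mono le_floor_add)
    finally show ?thesis .
  qed
  then show ?thesis by (simp add: floor_pt_def less_eq_vec_def)
qed

lemma nonneg_vec_neq_0:
  fixes u :: "real ^ 'd"
  assumes "0 \<le> u" "u \<noteq> 0"
  obtains i where "u $ i > 0"
  using assms by (force simp: vec_eq_iff less_eq_vec_def less_le)

lemma floor_pt_neq_0: "u $ i > 0 \<Longrightarrow> t \<ge> 1 / u $ i \<Longrightarrow> floor_pt (t *\<^sub>R u) \<noteq> 0"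
proof -
  assume u: "u $ i > 0" "t \<ge> 1 / u $ i"
  then have "1 \<le> t * u $ i" by (simp add: field_simps)
  then have "1 \<le> \<lfloor>t * u $ i\<rfloor>" by simp
  then have "floor_pt (t *\<^sub>R u) $ i \<noteq> 0" by (simp add: floor_pt_def)
  then show ?thesis by auto
qed

lemma eventually_floor_pt_neq_0:
  assumes "0 \<le> u" "u \<noteq> 0"
  shows "\<forall>\<^sub>F t in at_top. floor_pt (t *\<^sub>R u) \<noteq> 0"
proof -
  obtain i where "u $ i > 0" using nonneg_vec_neq_0[OF assms] .
  then show ?thesis
    using floor_pt_neq_0 by (auto simp: eventually_at_top_linorder intro!: exI[of _ "1 / u $ i"])
qed

lemma coord_sum_mono:
  fixes u v :: "'a::ordered_comm_monoid_add ^ 'd"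
  shows "u \<le> v \<Longrightarrow> coord_sum u \<le> coord_sum v"
  unfolding coord_sum_def less_eq_vec_def by (intro sum_mono) auto

lemma coord_sum_scaleR: "coord_sum (t *\<^sub>R u) = t * coord_sum (u :: real ^ 'd)"
  by (simp add: coord_sum_def sum_distrib_left)

lemma collapse_nonneg: "0 \<le> u \<Longrightarrow> 0 \<le> collapse B k (u :: real ^ 'd)"
  by (simp add: collapse_def less_eq_vec_def sum_nonneg)

lemma collapse_scaleR: "collapse B k (t *\<^sub>R u) = t *\<^sub>R collapse B k (u :: real ^ 'd)"
  by (simp add: collapse_def vec_eq_iff sum_distrib_left algebra_simps)

text \<open>Fractions lost by separate rounding can combine into whole steps, never the reverse, so
  again steps need only be appended.\<close>

lemma collapse_floor_pt_le:
  fixes x :: "real ^ 'd"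
  assumes "0 \<le> x"
  shows "collapse B k (floor_pt x) \<le> floor_pt (collapse B k x)"
proof -
  have x: "0 \<le> x $ i" for i using assms by (simp add: less_eq_vec_def)
  have *: "real (nat \<lfloor>x $ i\<rfloor>) \<le> x $ i" for i using x[of i] by simp
  have "nat \<lfloor>x $ k\<rfloor> + (\<Sum>j\<in>B. nat \<lfloor>x $ j\<rfloor>) \<le> nat \<lfloor>x $ k + (\<Sum>j\<in>B. x $ j)\<rfloor>"
  proof -
    have "real (nat \<lfloor>x $ k\<rfloor> + (\<Sum>j\<in>B. nat \<lfloor>x $ j\<rfloor>)) \<le> x $ k + (\<Sum>j\<in>B. x $ j)"
      using * by (auto intro!: add_mono sum_mono)
    then show ?thesis by (simp add: le_nat_floor)
  qed
  then show ?thesis by (auto simp: collapse_def floor_pt_def less_eq_vec_def)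
qed

section \<open>Exponents at finite scale and their limit\<close>

context iid_weights
begin

text \<open>Sending the n-th point of an axis to \<open>v n\<close> is injective, so the weights at
  any distinct points have the law of those along the axis.\<close>

lemma walk_tail:
  assumes "inj_on v {1..n}"
  shows "prob {w \<in> space M. (\<Sum>j=1..n. \<omega> (v j) w) \<ge> r} = tail (axis i n) r"
proof -
  let ?\<phi> = "\<lambda>p. v (p $ i)" and ?S = "axis i ` {1..n}" and ?A = "{map (axis i) [1..<Suc n]}"
  have inj: "inj_on ?\<phi> ?S"
    by (rule inj_onI) (auto dest: inj_onD[OF assms] simp: axis_nth)
  have img: "map ?\<phi> ` ?A = {map v [1..<Suc n]}"
    by (simp add: comp_def axis_nth del: upt_Suc)
  have "gibbs_sum \<omega> {map v [1..<Suc n]} w = exp (\<Sum>j=1..n. \<omega> (v j) w)" for w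
    unfolding gibbs_sum_def
    by (simp add: comp_def interv_sum_list_conv_sum_set_nat atLeastLessThanSuc_atLeastAtMost del: upt_Suc)
  then have "prob {w \<in> space M. (\<Sum>j=1..n. \<omega> (v j) w) \<ge> r}
      = prob {w \<in> space M. gibbs_sum \<omega> (map ?\<phi> ` ?A) w \<in> {exp r..}}"
    unfolding img by simp
  also have "\<dots> = prob {w \<in> space M. gibbs_sum \<omega> ?A w \<in> {exp r..}}"
    by (rule gibbs_sum_law[OF inj, symmetric]) auto
  finally show ?thesis by (simp add: tail_eq site_lists_axis del: upt_Suc)
qed

lemma tail_axis_1: "tail (axis i 1) r = prob {w \<in> space M. \<omega> 0 w \<ge> r}"
  \<comment> \<open>A constant map is injective on the one-point set \<open>{1..1}\<close>.\<close>
  using walk_tail[of "\<lambda>_. 0" 1 r i] by simp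

text \<open>Since \<open>ln 0 = 0\<close>, this is the true exponent only where the tail is
  positive. At \<open>u = 0\<close> the partition function is 1 and the tail vanishes for
  \<open>r > 0\<close>, hence the assumptions \<open>u \<noteq> 0\<close> in later
  estimates.\<close>

definition tail_rate :: "nat ^ 'd \<Rightarrow> real \<Rightarrow> real" where
  "tail_rate u r = - ln (tail u r)"

lemma tail_rate_nonneg: "tail_rate u r \<ge> 0"
  using tail_nonneg[of u r] tail_le_1[of u r]
  by (cases "tail u r = 0") (auto simp: tail_rate_def less_le)

text \<open>The price of forcing one weight to be nonnegative, so that appending its site does not
  lower the path sum. It is the constant in the one-sided comparison of points.\<close>

definition site_cost :: real where
  "site_cost = - ln (prob {w \<in> space M. \<omega> 0 w \<ge> 0})"

end

text \<open>One of the two uses of \<open>alpha_inf < \<infinity>\<close>: by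
  \<open>alpha_inf_bounded\<close>, weights that are almost surely bounded above have infinite
  slope.\<close>

locale unbounded_weights = iid_weights M \<omega>
  for M :: "'w measure" and \<omega> :: "nat ^ 'd \<Rightarrow> 'w \<Rightarrow> real" +
  assumes unbounded: "\<And>r. prob {w \<in> space M. \<omega> 0 w \<ge> r} > 0"
begin

lemma site_cost_nonneg: "site_cost \<ge> 0"
  using unbounded[of 0] by (simp add: site_cost_def)

lemma tail_add_endpoint:
  "tail u r * prob {w \<in> space M. \<omega> 0 w \<ge> 0} ^ length ds \<le> tail (u + endpoint ds) r"
proof (induction ds arbitrary: u)
  case (Cons i ds)
  have "tail u r * prob {w \<in> space M. \<omega> 0 w \<ge> 0} \<le> tail (u + axis i 1) r"
    using tail_superadditive[of u r "axis i 1" 0] by (simp add: tail_axis_1 del: One_nat_def)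
  then have "tail u r * prob {w \<in> space M. \<omega> 0 w \<ge> 0} * prob {w \<in> space M. \<omega> 0 w \<ge> 0} ^ length ds
      \<le> tail (u + axis i 1) r * prob {w \<in> space M. \<omega> 0 w \<ge> 0} ^ length ds"
    by (rule mult_right_mono) simp
  also have "\<dots> \<le> tail (u + axis i 1 + endpoint ds) r" by (rule Cons)
  finally show ?case by (simp add: mult_ac add_ac)
qed simp

text \<open>Let the first site of a path carry weight at least \<open>r\<close> and all later sites
  nonnegative weights.\<close>

lemma tail_pos:
  assumes "u \<noteq> 0"
  shows "tail u r > 0"
proof -
  obtain ds where ds: "endpoint ds = u" using exists_word by blast
  with assms obtain i es where "ds = i # es" by (cases ds) auto
  with ds have u: "u = axis i 1 + endpoint es" by simp
  have "0 < tail (axis i 1) r * prob {w \<in> space M. \<omega> 0 w \<ge> 0} ^ length es"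
    unfolding tail_axis_1 using unbounded by simp
  also have "\<dots> \<le> tail u r" unfolding u by (rule tail_add_endpoint)
  finally show ?thesis .
qed

lemma tail_rate_mono: "u \<noteq> 0 \<Longrightarrow> r \<le> s \<Longrightarrow> tail_rate u r \<le> tail_rate u s"
  using tail_pos[of u s] tail_antimono[of r s u] by (simp add: tail_rate_def)

lemma tail_rate_subadditive:
  assumes "u \<noteq> 0" "v \<noteq> 0"
  shows "tail_rate (u + v) (r + s) \<le> tail_rate u r + tail_rate v s"
proof -
  have "ln (tail u r * tail v s) \<le> ln (tail (u + v) (r + s))"
    using assms by (intro ln_mono tail_superadditive mult_pos_pos tail_pos) auto
  then show ?thesis
    using tail_pos[OF assms(1), of r] tail_pos[OF assms(2), of s]
    by (simp add: tail_rate_def ln_mult_pos)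
qed

lemma tail_rate_le:
  assumes "u \<noteq> 0" "u \<le> v"
  shows "tail_rate v r \<le> tail_rate u r + site_cost * (real (coord_sum v) - real (coord_sum u))"
proof -
  define w where "w = (\<chi> i. v $ i - u $ i)"
  have v: "v = u + w" using assms(2) by (simp add: w_def vec_eq_iff less_eq_vec_def)
  obtain ds where ds: "endpoint ds = w" using exists_word by blast
  have len: "length ds = coord_sum w" using ds coord_sum_endpoint by metis
  let ?c = "prob {w \<in> space M. \<omega> 0 w \<ge> 0}"
  have "ln (tail u r * ?c ^ length ds) \<le> ln (tail v r)"
    using tail_add_endpoint[of u r ds] tail_pos[OF assms(1)] unbounded[of 0] ds v
    by (intro ln_mono) auto
  then show ?thesis
    using tail_pos[OF assms(1), of r] unbounded[of 0]
    by (simp add: tail_rate_def site_cost_def ln_mult ln_realpow len v coord_sum_add algebra_simps)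
qed

lemma tail_rate_0_le:
  assumes "u \<noteq> 0"
  shows "tail_rate u 0 \<le> site_cost * real (coord_sum u)"
proof -
  obtain i where "u $ i \<noteq> 0" using assms by (auto simp: vec_eq_iff)
  then have le: "axis i 1 \<le> u" by (auto simp: axis_def less_eq_vec_def)
  have "tail_rate (axis i 1) 0 = site_cost"
    unfolding tail_rate_def site_cost_def tail_axis_1 ..
  with tail_rate_le[OF _ le, of 0] show ?thesis by (simp add: algebra_simps)
qed

text \<open>\<open>D\<close> is only bounded below because scaled real coordinates dominate those of
  the rounded point; the limit is then taken with \<open>D\<close> proportional to the
  scale.\<close>

lemma tail_rate_collapse:
  assumes k: "k \<notin> B" and t: "0 < t" "t \<le> 1" and u: "u \<noteq> 0"
    and D: "D \<ge> real (\<Sum>i\<in>B. u $ i) * ln (1 / t) + real (coord_sum u) * (real CARD('d) * t)"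
  shows "tail_rate (collapse B k u) (r - D) - D \<le> tail_rate u r"
proof -
  let ?E = "real (\<Sum>i\<in>B. u $ i) * ln (1 / t) + real (coord_sum u) * (real CARD('d) * t)"
  have c: "collapse B k u \<noteq> 0"
    using u coord_sum_collapse[OF k, of u] by (metis coord_sum_eq_0_iff_nat)
  have "tail u r \<le> exp ?E * tail (collapse B k u) (r - ?E)"
    by (rule tail_collapse[OF k t])
  also have "\<dots> \<le> exp D * tail (collapse B k u) (r - D)"
    using D by (intro mult_mono tail_antimono tail_nonneg) auto
  finally have "ln (tail u r) \<le> ln (exp D * tail (collapse B k u) (r - D))"
    using tail_pos[OF u] by (intro ln_mono) auto
  then show ?thesis using tail_pos[OF c, of "r - D"] by (simp add: tail_rate_def ln_mult_pos)
qed

text \<open>The limit runs over real \<open>t\<close>, so that rescaling \<open>u\<close> by any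
  positive real is a change of variable; restriction to integers gives back the limit in
  \<open>J_rate\<close>.\<close>

definition J :: "real ^ 'd \<Rightarrow> real \<Rightarrow> real" where
  "J u r = Lim at_top (\<lambda>t. tail_rate (floor_pt (t *\<^sub>R u)) (t * r) / t)"

lemma tendsto_J:
  assumes u: "0 \<le> u" "u \<noteq> 0"
  shows "((\<lambda>t. tail_rate (floor_pt (t *\<^sub>R u)) (t * r) / t) \<longlongrightarrow> J u r) at_top"
proof -
  obtain i where i: "u $ i > 0" using nonneg_vec_neq_0[OF u] .
  \<comment> \<open>From this scale on coordinate \<open>i\<close> has reached 1, so rounding gives
    a nonzero point.\<close>
  define a where "a = 1 / u $ i"
  have a: "a > 0" using i by (simp add: a_def)
  have nz: "floor_pt (t *\<^sub>R u) \<noteq> 0" if "t \<ge> a" for t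
    using floor_pt_neq_0[OF i] that by (simp add: a_def)
  have tu: "0 \<le> t *\<^sub>R u" if "t \<ge> a" for t
    using u a that by (simp add: less_eq_vec_def)
  let ?f = "\<lambda>t. tail_rate (floor_pt (t *\<^sub>R u)) (t * r)"
  have "\<exists>l. ((\<lambda>t. ?f t / t) \<longlongrightarrow> l) at_top"
  proof (rule fekete_at_top[OF a])
    show "?f t \<ge> 0" for t by (rule tail_rate_nonneg)
    \<comment> \<open>Each of the two roundings loses at most \<open>CARD('d)\<close> steps, and
      each lost step costs \<open>site_cost\<close>.\<close>
    show "?f (s + t) \<le> ?f s + ?f t + site_cost * (2 * real CARD('d))" if st: "s \<ge> a" "t \<ge> a" for s t
    proof -
      let ?x = "floor_pt (s *\<^sub>R u)" and ?y = "floor_pt (t *\<^sub>R u)" and ?z = "floor_pt ((s + t) *\<^sub>R u)"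
      have le: "?x + ?y \<le> ?z"
        using floor_pt_add_le[OF tu[OF st(1)] tu[OF st(2)]] by (simp add: scaleR_add_left)
      have "?x + ?y \<noteq> 0" using nz[OF st(1)] by (auto simp: vec_eq_iff)
      then have "?f (s + t) \<le> tail_rate (?x + ?y) ((s + t) * r)
          + site_cost * (real (coord_sum ?z) - real (coord_sum (?x + ?y)))"
        using le by (rule tail_rate_le)
      moreover have "tail_rate (?x + ?y) ((s + t) * r) \<le> ?f s + ?f t"
        using tail_rate_subadditive[OF nz[OF st(1)] nz[OF st(2)]] by (simp add: distrib_right)
      moreover have "real (coord_sum ?z) - real (coord_sum (?x + ?y)) \<le> 2 * real CARD('d)"
        using coord_sum_floor_pt[OF tu[OF st(1)]] coord_sum_floor_pt[OF tu[OF st(2)]]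
          coord_sum_floor_pt[OF tu[of "s + t"]] st a
        by (simp add: coord_sum_add coord_sum_scaleR distrib_right)
      then have "site_cost * (real (coord_sum ?z) - real (coord_sum (?x + ?y)))
          \<le> site_cost * (2 * real CARD('d))"
        by (intro mult_left_mono site_cost_nonneg)
      ultimately show ?thesis by linarith
    qed
    \<comment> \<open>On a bounded range every point dominates the rounding of
      \<open>a *\<^sub>R u\<close>, whose tails are compared at the highest level
      \<open>b * \<bar>r\<bar>\<close>.\<close>
    show "\<exists>K. \<forall>t\<in>{a..b}. ?f t \<le> K" for b
    proof (intro exI ballI)
      fix t assume t: "t \<in> {a..b}"
      let ?x = "floor_pt (a *\<^sub>R u)"
      have "a *\<^sub>R u \<le> t *\<^sub>R u" using t u by (simp add: less_eq_vec_def mult_right_mono)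
      then have "?f t \<le> tail_rate ?x (t * r)
          + site_cost * (real (coord_sum (floor_pt (t *\<^sub>R u))) - real (coord_sum ?x))"
        by (intro tail_rate_le nz floor_pt_mono) auto
      also have "\<dots> \<le> tail_rate ?x (b * \<bar>r\<bar>) + site_cost * real (coord_sum (floor_pt (b *\<^sub>R u)))"
      proof (intro add_mono tail_rate_mono nz mult_left_mono site_cost_nonneg)
        have "t * r \<le> t * \<bar>r\<bar>" using t a by (intro mult_left_mono) auto
        also have "\<dots> \<le> b * \<bar>r\<bar>" using t by (intro mult_right_mono) auto
        finally show "t * r \<le> b * \<bar>r\<bar>" .
        have "t *\<^sub>R u \<le> b *\<^sub>R u" using t u by (simp add: less_eq_vec_def mult_right_mono)
        from coord_sum_mono[OF floor_pt_mono[OF this]]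
        show "real (coord_sum (floor_pt (t *\<^sub>R u))) - real (coord_sum ?x)
            \<le> real (coord_sum (floor_pt (b *\<^sub>R u)))" by simp
      qed simp
      finally show "?f t \<le> tail_rate ?x (b * \<bar>r\<bar>) + site_cost * real (coord_sum (floor_pt (b *\<^sub>R u)))" .
    qed
  qed
  then obtain l where l: "((\<lambda>t. ?f t / t) \<longlongrightarrow> l) at_top" by blast
  have "J u r = l" unfolding J_def by (rule tendsto_Lim[OF _ l]) simp
  with l show ?thesis by simp
qed

end

section \<open>Continuity away from the origin\<close>

lemma coord_sum_pos:
  fixes v :: "real ^ 'd"
  assumes "0 \<le> v" "v \<noteq> 0"
  shows "coord_sum v > 0"
proof -
  obtain i where "v $ i > 0" using nonneg_vec_neq_0[OF assms] .
  then show ?thesis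
    unfolding coord_sum_def using assms(1) by (intro sum_pos2[of _ i]) (auto simp: less_eq_vec_def)
qed

section \<open>Homogeneity, convexity and comparison of points in the limit\<close>

context unbounded_weights
begin

lemma J_nonneg:
  assumes "0 \<le> u" "u \<noteq> 0"
  shows "J u r \<ge> 0"
proof (rule tendsto_lowerbound[OF tendsto_J[OF assms]])
  show "\<forall>\<^sub>F t in at_top. 0 \<le> tail_rate (floor_pt (t *\<^sub>R u)) (t * r) / t"
    using eventually_gt_at_top[of 0] by eventually_elim (simp add: tail_rate_nonneg)
qed simp

lemma J_mono:
  assumes "0 \<le> u" "u \<noteq> 0" "r \<le> s"
  shows "J u r \<le> J u s"
proof (rule tendsto_le[OF _ tendsto_J[OF assms(1,2)] tendsto_J[OF assms(1,2)]])
  show "\<forall>\<^sub>F t in at_top. tail_rate (floor_pt (t *\<^sub>R u)) (t * r) / t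
      \<le> tail_rate (floor_pt (t *\<^sub>R u)) (t * s) / t"
    using eventually_gt_at_top[of 0] eventually_floor_pt_neq_0[OF assms(1,2)]
    by eventually_elim (use assms(3) in \<open>auto intro!: divide_right_mono tail_rate_mono mult_left_mono\<close>)
qed simp

lemma J_scale:
  assumes "0 \<le> u" "u \<noteq> 0" "c > 0"
  shows "J (c *\<^sub>R u) (c * r) = c * J u r"
proof (rule tendsto_unique[OF _ tendsto_J])
  have "filterlim (\<lambda>t. c * t) at_top at_top"
    using assms(3) by (intro filterlim_tendsto_pos_mult_at_top[OF tendsto_const] filterlim_ident)
  from filterlim_compose[OF tendsto_J[OF assms(1,2), of r] this]
  have "((\<lambda>t. c * (tail_rate (floor_pt ((c * t) *\<^sub>R u)) (c * t * r) / (c * t))) \<longlongrightarrow> c * J u r) at_top"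
    by (rule tendsto_mult_left)
  then show "((\<lambda>t. tail_rate (floor_pt (t *\<^sub>R c *\<^sub>R u)) (t * (c * r)) / t) \<longlongrightarrow> c * J u r) at_top"
    using assms(3) by (simp add: mult_ac)
qed (use assms in \<open>auto simp: less_eq_vec_def\<close>)

lemma J_scale':
  assumes "0 \<le> u" "u \<noteq> 0" "c > 0"
  shows "J (c *\<^sub>R u) r = c * J u (r / c)"
  using J_scale[OF assms, of "r / c"] assms(3) by simp

lemma J_subadditive:
  assumes u: "0 \<le> u" "u \<noteq> 0" and v: "0 \<le> v" "v \<noteq> 0"
  shows "J (u + v) (r + s) \<le> J u r + J v s"
proof -
  have uv: "0 \<le> u + v" "u + v \<noteq> 0"
    using u v by (auto simp: less_eq_vec_def vec_eq_iff add_nonneg_eq_0_iff)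
  let ?f = "\<lambda>u r t. tail_rate (floor_pt (t *\<^sub>R u)) (t * r) / t"
  let ?C = "site_cost * (2 * real CARD('d))"
  have "((\<lambda>t. ?f u r t + ?f v s t + ?C / t) \<longlongrightarrow> J u r + J v s + 0) at_top"
    by (intro tendsto_add tendsto_J u v tendsto_divide_0[OF tendsto_const]
        filterlim_at_top_imp_at_infinity filterlim_ident)
  moreover have "\<forall>\<^sub>F t in at_top. ?f (u + v) (r + s) t \<le> ?f u r t + ?f v s t + ?C / t"
    using eventually_gt_at_top[of 0] eventually_floor_pt_neq_0[OF u] eventually_floor_pt_neq_0[OF v]
  proof eventually_elim
    case (elim t)
    let ?x = "floor_pt (t *\<^sub>R u)" and ?y = "floor_pt (t *\<^sub>R v)" and ?z = "floor_pt (t *\<^sub>R (u + v))"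
    have 0: "0 \<le> t *\<^sub>R u" "0 \<le> t *\<^sub>R v" "0 \<le> t *\<^sub>R (u + v)"
      using u v uv elim by (auto simp: less_eq_vec_def)
    have le: "?x + ?y \<le> ?z"
      using floor_pt_add_le[OF 0(1,2)] by (simp add: scaleR_add_right)
    have "?x + ?y \<noteq> 0" using elim by (auto simp: vec_eq_iff)
    then have "tail_rate ?z (t * (r + s)) \<le> tail_rate (?x + ?y) (t * (r + s))
        + site_cost * (real (coord_sum ?z) - real (coord_sum (?x + ?y)))"
      using le by (rule tail_rate_le)
    moreover have "tail_rate (?x + ?y) (t * (r + s)) \<le> tail_rate ?x (t * r) + tail_rate ?y (t * s)"
      using tail_rate_subadditive[OF elim(2,3)] by (simp add: distrib_left)
    moreover have "real (coord_sum ?z) - real (coord_sum (?x + ?y)) \<le> 2 * real CARD('d)"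
      using coord_sum_floor_pt[OF 0(1)] coord_sum_floor_pt[OF 0(2)] coord_sum_floor_pt[OF 0(3)]
      by (simp add: coord_sum_add scaleR_add_right)
    then have "site_cost * (real (coord_sum ?z) - real (coord_sum (?x + ?y))) \<le> ?C"
      by (intro mult_left_mono site_cost_nonneg)
    ultimately have "tail_rate ?z (t * (r + s)) \<le> tail_rate ?x (t * r) + tail_rate ?y (t * s) + ?C"
      by linarith
    then show ?case
      using elim(1) by (simp add: add_divide_distrib[symmetric] divide_right_mono)
  qed
  ultimately have "J (u + v) (r + s) \<le> J u r + J v s + 0"
    by (intro tendsto_le[OF _ _ tendsto_J[OF uv]]) auto
  then show ?thesis by simp
qed

text \<open>Splitting \<open>u\<close> into two proportional parts turns subadditivity in the pair
  into convexity in the level, once homogeneity has extracted the factors.\<close>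

lemma J_convex:
  assumes u: "0 \<le> u" "u \<noteq> 0"
  shows "convex_on UNIV (J u)"
proof (rule convex_onI)
  fix t x y :: real assume t: "0 < t" "t < 1"
  have "J u ((1 - t) *\<^sub>R x + t *\<^sub>R y) = J ((1 - t) *\<^sub>R u + t *\<^sub>R u) ((1 - t) * x + t * y)"
    by (simp add: scaleR_add_left[symmetric])
  also have "\<dots> \<le> J ((1 - t) *\<^sub>R u) ((1 - t) * x) + J (t *\<^sub>R u) (t * y)"
    using u t by (intro J_subadditive) (auto simp: less_eq_vec_def)
  finally show "J u ((1 - t) *\<^sub>R x + t *\<^sub>R y) \<le> (1 - t) * J u x + t * J u y"
    using t by (simp add: J_scale[OF u])
qed simp

lemma tendsto_J_right:
  assumes "0 \<le> u" "u \<noteq> 0" "(r \<longlongrightarrow> r0) F"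
  shows "((\<lambda>x. J u (r x)) \<longlongrightarrow> J u r0) F"
proof -
  have "isCont (J u) r0"
    using convex_on_continuous[OF open_UNIV J_convex[OF assms(1,2)]]
    by (simp add: continuous_on_eq_continuous_at)
  then show ?thesis using assms(3) by (rule isCont_tendsto_compose)
qed

lemma J_le:
  assumes u: "0 \<le> u" "u \<noteq> 0" and uv: "u \<le> v"
  shows "J v r \<le> J u r + site_cost * (coord_sum v - coord_sum u)"
proof -
  have v: "0 \<le> v" "v \<noteq> 0"
    using u uv by (auto intro: order_trans order_antisym)
  let ?f = "\<lambda>u r t. tail_rate (floor_pt (t *\<^sub>R u)) (t * r) / t"
  let ?C = "site_cost * real CARD('d)" and ?E = "site_cost * (coord_sum v - coord_sum u)"
  have "((\<lambda>t. ?f u r t + ?E + ?C / t) \<longlongrightarrow> J u r + ?E + 0) at_top"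
    by (intro tendsto_add tendsto_J u tendsto_divide_0[OF tendsto_const] tendsto_const
        filterlim_at_top_imp_at_infinity filterlim_ident)
  moreover have "\<forall>\<^sub>F t in at_top. ?f v r t \<le> ?f u r t + ?E + ?C / t"
    using eventually_gt_at_top[of 0] eventually_floor_pt_neq_0[OF u]
  proof eventually_elim
    case (elim t)
    let ?x = "floor_pt (t *\<^sub>R u)" and ?y = "floor_pt (t *\<^sub>R v)"
    have 0: "0 \<le> t *\<^sub>R u" "0 \<le> t *\<^sub>R v" "t *\<^sub>R u \<le> t *\<^sub>R v"
      using u v uv elim by (auto simp: less_eq_vec_def)
    have "tail_rate ?y (t * r) \<le> tail_rate ?x (t * r)
        + site_cost * (real (coord_sum ?y) - real (coord_sum ?x))"
      by (intro tail_rate_le elim floor_pt_mono 0)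
    moreover have "site_cost * (real (coord_sum ?y) - real (coord_sum ?x))
        \<le> site_cost * (t * (coord_sum v - coord_sum u) + real CARD('d))"
      using coord_sum_floor_pt[OF 0(1)] coord_sum_floor_pt[OF 0(2)]
      by (intro mult_left_mono site_cost_nonneg) (simp add: coord_sum_scaleR right_diff_distrib)
    ultimately have "tail_rate ?y (t * r) \<le> tail_rate ?x (t * r) + t * ?E + ?C"
      by (simp add: algebra_simps)
    then have "?f v r t \<le> (tail_rate ?x (t * r) + t * ?E + ?C) / t"
      using elim(1) by (intro divide_right_mono) auto
    then show ?case using elim(1) by (simp add: add_divide_distrib)
  qed
  ultimately have "J v r \<le> J u r + ?E + 0"
    by (intro tendsto_le[OF _ _ tendsto_J[OF v]]) auto
  then show ?thesis by simp
qed

lemma J_0_le: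
  assumes u: "0 \<le> u" "u \<noteq> 0"
  shows "J u 0 \<le> site_cost * coord_sum u"
proof (rule tendsto_upperbound[OF tendsto_J[OF u]])
  show "\<forall>\<^sub>F t in at_top. tail_rate (floor_pt (t *\<^sub>R u)) (t * 0) / t \<le> site_cost * coord_sum u"
    using eventually_gt_at_top[of 0] eventually_floor_pt_neq_0[OF u]
  proof eventually_elim
    case (elim t)
    have "0 \<le> t *\<^sub>R u" using u elim by (auto simp: less_eq_vec_def)
    have "tail_rate (floor_pt (t *\<^sub>R u)) 0 \<le> site_cost * real (coord_sum (floor_pt (t *\<^sub>R u)))"
      using elim by (intro tail_rate_0_le)
    also have "\<dots> \<le> site_cost * (t * coord_sum u)"
      using coord_sum_floor_pt(1)[OF \<open>0 \<le> t *\<^sub>R u\<close>]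
      by (intro mult_left_mono site_cost_nonneg) (simp add: coord_sum_scaleR)
    finally show ?case using elim by (simp add: field_simps)
  qed
qed simp

text \<open>The cost \<open>D\<close> is linear in \<open>u\<close>, so it survives the scaling
  limit unchanged, while rounding has a bounded cost that disappears after division by the
  scale.\<close>

lemma J_collapse:
  assumes k: "k \<notin> B" and t: "0 < t" "t \<le> 1" and u: "0 \<le> u" "u \<noteq> 0"
  defines "D \<equiv> (\<Sum>i\<in>B. u $ i) * ln (1 / t) + coord_sum u * (real CARD('d) * t)"
  shows "J (collapse B k u) (r - D) - D \<le> J u r"
proof -
  define u' where "u' = collapse B k u"
  have cs: "coord_sum u' = coord_sum u" by (simp add: u'_def coord_sum_collapse[OF k])
  have u': "0 \<le> u'" "u' \<noteq> 0"
    using collapse_nonneg[OF u(1)] coord_sum_pos[OF u] cs by (auto simp: u'_def)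
  let ?f = "\<lambda>u r t. tail_rate (floor_pt (t *\<^sub>R u)) (t * r) / t"
  let ?C = "site_cost * real CARD('d)"
  have "((\<lambda>T. ?f u r T + D + ?C / T) \<longlongrightarrow> J u r + D + 0) at_top"
    by (intro tendsto_add tendsto_J u tendsto_divide_0[OF tendsto_const] tendsto_const
        filterlim_at_top_imp_at_infinity filterlim_ident)
  moreover have "\<forall>\<^sub>F T in at_top. ?f u' (r - D) T \<le> ?f u r T + D + ?C / T"
    using eventually_gt_at_top[of 0] eventually_floor_pt_neq_0[OF u]
  proof eventually_elim
    case (elim T)
    let ?x = "floor_pt (T *\<^sub>R u)" and ?y = "floor_pt (T *\<^sub>R u')" and ?z = "collapse B k (floor_pt (T *\<^sub>R u))"
    have 0: "0 \<le> T *\<^sub>R u" "0 \<le> T *\<^sub>R u'"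
      using u u' elim by (auto simp: less_eq_vec_def)
    have le: "?z \<le> ?y"
      using collapse_floor_pt_le[OF 0(1)] by (simp add: u'_def collapse_scaleR)
    have zx: "coord_sum ?z = coord_sum ?x" by (rule coord_sum_collapse[OF k])
    then have z: "?z \<noteq> 0" using elim by (metis coord_sum_eq_0_iff_nat)
    have "real (\<Sum>i\<in>B. ?x $ i) \<le> T * (\<Sum>i\<in>B. u $ i)"
      unfolding of_nat_sum sum_distrib_left
    proof (rule sum_mono)
      fix i show "real (?x $ i) \<le> T * u $ i"
        using 0(1) by (simp add: floor_pt_def less_eq_vec_def)
    qed
    then have "real (\<Sum>i\<in>B. ?x $ i) * ln (1 / t) + real (coord_sum ?x) * (real CARD('d) * t)
        \<le> T * (\<Sum>i\<in>B. u $ i) * ln (1 / t) + T * coord_sum u * (real CARD('d) * t)"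
      using t coord_sum_floor_pt(1)[OF 0(1)]
      by (intro add_mono mult_right_mono) (auto simp: coord_sum_scaleR)
    also have "\<dots> = T * D" by (simp add: D_def algebra_simps)
    finally have "tail_rate ?z (T * r - T * D) - T * D \<le> tail_rate ?x (T * r)"
      by (rule tail_rate_collapse[OF k t elim(2)])
    moreover have "tail_rate ?y (T * r - T * D) \<le> tail_rate ?z (T * r - T * D)
        + site_cost * (real (coord_sum ?y) - real (coord_sum ?z))"
      by (rule tail_rate_le[OF z le])
    moreover have "site_cost * (real (coord_sum ?y) - real (coord_sum ?z)) \<le> ?C"
      using coord_sum_floor_pt[OF 0(1)] coord_sum_floor_pt[OF 0(2)]
      by (intro mult_left_mono site_cost_nonneg) (simp add: zx coord_sum_scaleR cs)
    ultimately have "tail_rate ?y (T * (r - D)) \<le> tail_rate ?x (T * r) + T * D + ?C"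
      by (simp add: right_diff_distrib)
    then have "?f u' (r - D) T \<le> (tail_rate ?x (T * r) + T * D + ?C) / T"
      using elim(1) by (intro divide_right_mono) auto
    then show ?case using elim(1) by (simp add: add_divide_distrib)
  qed
  ultimately have "J u' (r - D) \<le> J u r + D + 0"
    by (intro tendsto_le[OF _ _ tendsto_J[OF u']]) auto
  then show ?thesis by (simp add: u'_def)
qed

lemma tendsto_J_pair:
  fixes u :: "'x \<Rightarrow> real ^ 'd" and r :: "'x \<Rightarrow> real"
  assumes u0: "0 \<le> u0" "u0 \<noteq> 0" and u: "(u \<longlongrightarrow> u0) F" and r: "(r \<longlongrightarrow> r0) F"
    and nonneg: "\<forall>\<^sub>F x in F. 0 \<le> u x"
  shows "((\<lambda>x. J (u x) (r x)) \<longlongrightarrow> J u0 r0) F"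
proof -
  have ui: "((\<lambda>x. u x $ i) \<longlongrightarrow> u0 $ i) F" for i using u by (rule tendsto_vec_nth)
  have us: "((\<lambda>x. coord_sum (u x)) \<longlongrightarrow> coord_sum u0) F"
    unfolding coord_sum_def by (intro tendsto_sum ui)
  have u0i: "u0 $ i \<ge> 0" for i using u0(1) by (simp add: less_eq_vec_def)
  obtain k where k: "u0 $ k > 0" using nonneg_vec_neq_0[OF u0] .
  have "\<forall>\<^sub>F x in F. u x $ k > 0" using ui k by (rule order_tendstoD)
  then have nz: "\<forall>\<^sub>F x in F. u x \<noteq> 0" by eventually_elim auto
  show ?thesis
  proof (rule order_tendstoI)
    fix e assume e: "J u0 r0 < e"
    let ?g = "\<lambda>t. (1 - t) * J u0 (r0 / (1 - t)) + site_cost * (coord_sum u0 - (1 - t) * coord_sum u0)"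
    have "(?g \<longlongrightarrow> (1 - 0) * J u0 (r0 / (1 - 0)) + site_cost * (coord_sum u0 - (1 - 0) * coord_sum u0)) (at_right 0)"
      by (intro tendsto_intros tendsto_J_right u0) auto
    then have "\<forall>\<^sub>F t in at_right 0. ?g t < e"
      by (rule order_tendstoD) (use e in simp)
    moreover have "\<forall>\<^sub>F t::real in at_right 0. t \<in> {0<..<1}" by (rule eventually_at_right_real) simp
    ultimately obtain t where t: "?g t < e" "0 < t" "t < 1"
      using eventually_happens[OF eventually_conj] by fastforce
    \<comment> \<open>Where \<open>u0\<close> vanishes this is nonnegativity of \<open>u x\<close>;
      elsewhere \<open>(1 - t) * u0 $ i < u0 $ i\<close> leaves room.\<close>
    have "\<forall>\<^sub>F x in F. \<forall>i. (1 - t) * u0 $ i \<le> u x $ i"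
    proof (rule eventually_all_finite)
      fix i show "\<forall>\<^sub>F x in F. (1 - t) * u0 $ i \<le> u x $ i"
      proof (cases "u0 $ i = 0")
        case True
        show ?thesis
          using nonneg by eventually_elim (use True in \<open>simp add: less_eq_vec_def\<close>)
      next
        case False
        then have "(1 - t) * u0 $ i < u0 $ i" using t u0i[of i] by simp
        with ui[of i] have "\<forall>\<^sub>F x in F. (1 - t) * u0 $ i < u x $ i" by (rule order_tendstoD)
        then show ?thesis by eventually_elim simp
      qed
    qed
    then have "\<forall>\<^sub>F x in F. J (u x) (r x)
        \<le> (1 - t) * J u0 (r x / (1 - t)) + site_cost * (coord_sum (u x) - (1 - t) * coord_sum u0)"
    proof eventually_elim
      case (elim x)
      have "J (u x) (r x) \<le> J ((1 - t) *\<^sub>R u0) (r x)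
          + site_cost * (coord_sum (u x) - coord_sum ((1 - t) *\<^sub>R u0))"
        using elim t u0 by (intro J_le) (auto simp: less_eq_vec_def)
      then show ?case using t by (simp add: J_scale'[OF u0] coord_sum_scaleR)
    qed
    moreover have "((\<lambda>x. (1 - t) * J u0 (r x / (1 - t))
        + site_cost * (coord_sum (u x) - (1 - t) * coord_sum u0)) \<longlongrightarrow> ?g t) F"
      using t by (intro tendsto_intros tendsto_J_right u0 us r) auto
    then have "\<forall>\<^sub>F x in F. (1 - t) * J u0 (r x / (1 - t))
        + site_cost * (coord_sum (u x) - (1 - t) * coord_sum u0) < e"
      using t(1) by (rule order_tendstoD)
    ultimately show "\<forall>\<^sub>F x in F. J (u x) (r x) < e" by eventually_elim simp
  next
    fix e assume e: "e < J u0 r0"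
    \<comment> \<open>In these coordinates no multiple of \<open>u0\<close> dominates a positive
      entry of \<open>u x\<close>.\<close>
    define B where "B = {i. u0 $ i = 0}"
    have kB: "k \<notin> B" using k by (simp add: B_def)
    let ?D = "\<lambda>t v. (\<Sum>i\<in>B. v $ i) * ln (1 / t) + coord_sum v * (real CARD('d) * t)"
    \<comment> \<open>At \<open>u0\<close> the term with \<open>ln (1 / t)\<close> drops out, so the
      cost tends to 0 with \<open>t\<close>. For fixed \<open>t\<close>, the cost at
      \<open>u x\<close> converges to the cost at \<open>u0\<close>.\<close>
    have D0: "?D t u0 = coord_sum u0 * (real CARD('d) * t)" for t by (simp add: B_def)
    let ?g = "\<lambda>t. (1 + t) * J u0 ((r0 - ?D t u0) / (1 + t))
      - site_cost * ((1 + t) * coord_sum u0 - coord_sum u0) - ?D t u0"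
    have "(?g \<longlongrightarrow> (1 + 0) * J u0 ((r0 - coord_sum u0 * (real CARD('d) * 0)) / (1 + 0))
      - site_cost * ((1 + 0) * coord_sum u0 - coord_sum u0) - coord_sum u0 * (real CARD('d) * 0)) (at_right 0)"
      unfolding D0 by (intro tendsto_intros tendsto_J_right u0) auto
    then have "\<forall>\<^sub>F t in at_right 0. e < ?g t"
      by (rule order_tendstoD) (use e in simp)
    moreover have "\<forall>\<^sub>F t::real in at_right 0. t \<in> {0<..<1}" by (rule eventually_at_right_real) simp
    ultimately obtain t where t: "e < ?g t" "0 < t" "t < 1"
      using eventually_happens[OF eventually_conj] by fastforce
    \<comment> \<open>After the collapse the coordinates in \<open>B\<close> are exactly 0, and the
      mass moved to \<open>k\<close> tends to 0 while \<open>u0 $ k > 0\<close> leaves room for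
      it.\<close>
    have "\<forall>\<^sub>F x in F. \<forall>i. collapse B k (u x) $ i \<le> (1 + t) * u0 $ i"
    proof (rule eventually_all_finite)
      fix i
      show "\<forall>\<^sub>F x in F. collapse B k (u x) $ i \<le> (1 + t) * u0 $ i"
      proof (cases "i \<in> B")
        case True
        then show ?thesis using u0i[of i] t by (simp add: collapse_def)
      next
        case False
        then have "u0 $ i < (1 + t) * u0 $ i" using t u0i[of i] by (simp add: B_def)
        moreover have "((\<lambda>x. collapse B k (u x) $ i)
            \<longlongrightarrow> (if i = k then u0 $ k + (\<Sum>j\<in>B. u0 $ j) else u0 $ i)) F"
          using False by (auto simp: collapse_def intro!: tendsto_intros ui)
        then have "((\<lambda>x. collapse B k (u x) $ i) \<longlongrightarrow> u0 $ i) F"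
          by (cases "i = k") (simp_all add: B_def)
        ultimately have "\<forall>\<^sub>F x in F. collapse B k (u x) $ i < (1 + t) * u0 $ i"
          by (intro order_tendstoD(2)) auto
        then show ?thesis by eventually_elim simp
      qed
    qed
    then have "\<forall>\<^sub>F x in F. (1 + t) * J u0 ((r x - ?D t (u x)) / (1 + t))
        - site_cost * ((1 + t) * coord_sum u0 - coord_sum (u x)) - ?D t (u x) \<le> J (u x) (r x)"
      using nonneg nz
    proof eventually_elim
      case (elim x)
      have cs: "coord_sum (collapse B k (u x)) = coord_sum (u x)"
        by (rule coord_sum_collapse[OF kB])
      have "coord_sum (u x) > 0"
        using elim(2,3) by (rule coord_sum_pos)
      then have nz': "collapse B k (u x) \<noteq> 0" using cs by auto
      have "J ((1 + t) *\<^sub>R u0) (r x - ?D t (u x)) \<le> J (collapse B k (u x)) (r x - ?D t (u x))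
          + site_cost * (coord_sum ((1 + t) *\<^sub>R u0) - coord_sum (collapse B k (u x)))"
        using elim by (intro J_le collapse_nonneg nz') (auto simp: less_eq_vec_def)
      moreover have "J (collapse B k (u x)) (r x - ?D t (u x)) - ?D t (u x) \<le> J (u x) (r x)"
        using t elim by (intro J_collapse kB) auto
      ultimately show ?case
        using t by (simp add: J_scale'[OF u0] coord_sum_scaleR cs)
    qed
    moreover have "((\<lambda>x. (1 + t) * J u0 ((r x - ?D t (u x)) / (1 + t))
        - site_cost * ((1 + t) * coord_sum u0 - coord_sum (u x)) - ?D t (u x)) \<longlongrightarrow> ?g t) F"
      using t by (intro tendsto_intros tendsto_J_right u0 us ui r) auto
    then have "\<forall>\<^sub>F x in F. e < (1 + t) * J u0 ((r x - ?D t (u x)) / (1 + t))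
        - site_cost * ((1 + t) * coord_sum u0 - coord_sum (u x)) - ?D t (u x)"
      using t(1) by (rule order_tendstoD)
    ultimately show "\<forall>\<^sub>F x in F. e < J (u x) (r x)" by eventually_elim simp
  qed
qed

end

section \<open>The random walk and the Cramer rate function\<close>

lemma floor_pt_axis: "floor_pt (real n *\<^sub>R axis i 1) = axis i n"
  by (auto simp: floor_pt_def axis_def vec_eq_iff)

lemma axis_1_nonneg: "0 \<le> (axis i 1 :: real ^ 'd)" and axis_1_neq_0: "(axis i 1 :: real ^ 'd) \<noteq> 0"
  by (auto simp: less_eq_vec_def axis_def vec_eq_iff)

context iid_weights
begin

lemma expectation_exp_walk:
  assumes inj: "inj_on v {1..n}" and int: "integrable M (\<lambda>w. exp (\<xi> * \<omega> 0 w))"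
  shows "integrable M (\<lambda>w. exp (\<xi> * (\<Sum>j=1..n. \<omega> (v j) w)))"
    and "expectation (\<lambda>w. exp (\<xi> * (\<Sum>j=1..n. \<omega> (v j) w))) = expectation (\<lambda>w. exp (\<xi> * \<omega> 0 w)) ^ n"
proof -
  have ind: "indep_vars (\<lambda>_. borel) (\<lambda>j w. exp (\<xi> * \<omega> (v j) w)) {1..n}"
    by (rule indep_vars_compose2[OF indep_vars_reindex[OF indep_vars_subset[OF indep] inj]]) auto
  have *: "integrable M (\<lambda>w. exp (\<xi> * \<omega> u w))"
      "expectation (\<lambda>w. exp (\<xi> * \<omega> u w)) = expectation (\<lambda>w. exp (\<xi> * \<omega> 0 w))" for u
  proof -
    have "integrable (distr M borel (\<omega> 0)) (\<lambda>x. exp (\<xi> * x))"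
      using int by (simp add: integrable_distr_eq)
    then have "integrable (distr M borel (\<omega> u)) (\<lambda>x. exp (\<xi> * x))"
      by (simp only: ident[of u])
    then show "integrable M (\<lambda>w. exp (\<xi> * \<omega> u w))"
      by (simp add: integrable_distr_eq)
    have "expectation (\<lambda>w. exp (\<xi> * \<omega> u w)) = (\<integral>x. exp (\<xi> * x) \<partial>distr M borel (\<omega> u))"
      by (simp add: integral_distr)
    also have "\<dots> = (\<integral>x. exp (\<xi> * x) \<partial>distr M borel (\<omega> 0))" by (simp only: ident[of u])
    finally show "expectation (\<lambda>w. exp (\<xi> * \<omega> u w)) = expectation (\<lambda>w. exp (\<xi> * \<omega> 0 w))"
      by (simp add: integral_distr)
  qed
  have prod: "exp (\<xi> * (\<Sum>j=1..n. \<omega> (v j) w)) = (\<Prod>j=1..n. exp (\<xi> * \<omega> (v j) w))" for w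
    by (simp add: sum_distrib_left exp_sum)
  show "integrable M (\<lambda>w. exp (\<xi> * (\<Sum>j=1..n. \<omega> (v j) w)))"
    unfolding prod by (rule indep_vars_integrable[OF _ ind *(1)]) simp
  show "expectation (\<lambda>w. exp (\<xi> * (\<Sum>j=1..n. \<omega> (v j) w))) = expectation (\<lambda>w. exp (\<xi> * \<omega> 0 w)) ^ n"
    unfolding prod by (subst indep_vars_lebesgue_integral[OF _ ind *(1)]) (simp_all add: *(2)[of "v _"])
qed

lemma prob_site_ge: "prob {w \<in> space M. \<omega> u w \<ge> r} = prob {w \<in> space M. \<omega> 0 w \<ge> r}"
  using walk_tail[of "\<lambda>_. u" 1 r] walk_tail[of "\<lambda>_. 0" 1 r] by simp

text \<open>Weights almost surely below \<open>r\<close> have all their averages below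
  \<open>r\<close>, so the rate is infinite beyond that level and so is its slope.\<close>

lemma alpha_inf_bounded:
  assumes r: "prob {w \<in> space M. \<omega> 0 w \<ge> r} = 0"
  shows "alpha_inf M \<omega> v = \<infinity>"
proof -
  have 0: "prob {w \<in> space M. (\<Sum>i=1..n. \<omega> (v i) w) / real n \<in> {x - \<epsilon><..<x + \<epsilon>}} = 0"
    if "n \<ge> 1" "x - \<epsilon> \<ge> r" for n x \<epsilon>
  proof -
    have "prob {w \<in> space M. (\<Sum>i=1..n. \<omega> (v i) w) / real n \<in> {x - \<epsilon><..<x + \<epsilon>}}
        \<le> prob (\<Union>i\<in>{1..n}. {w \<in> space M. \<omega> (v i) w \<ge> r})"
    proof (rule finite_measure_mono)
      show "{w \<in> space M. (\<Sum>i=1..n. \<omega> (v i) w) / real n \<in> {x - \<epsilon><..<x + \<epsilon>}}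
          \<subseteq> (\<Union>i\<in>{1..n}. {w \<in> space M. \<omega> (v i) w \<ge> r})"
      proof
        fix w assume w: "w \<in> {w \<in> space M. (\<Sum>i=1..n. \<omega> (v i) w) / real n \<in> {x - \<epsilon><..<x + \<epsilon>}}"
        show "w \<in> (\<Union>i\<in>{1..n}. {w \<in> space M. \<omega> (v i) w \<ge> r})"
        proof (rule ccontr)
          assume "\<not> ?thesis"
          then have "\<omega> (v i) w \<le> r" if "i \<in> {1..n}" for i
            using w that by force
          then have "(\<Sum>i=1..n. \<omega> (v i) w) \<le> (\<Sum>i=1..n. r)"
            by (intro sum_mono)
          then have "(\<Sum>i=1..n. \<omega> (v i) w) / real n \<le> r"
            using that(1) by (simp add: field_simps)
          then show False using w that by auto
        qed
      qed
    qed measurable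
    also have "\<dots> \<le> (\<Sum>i=1..n. prob {w \<in> space M. \<omega> (v i) w \<ge> r})"
      by (intro finite_measure_subadditive_finite) auto
    also have "\<dots> = 0" by (simp add: prob_site_ge[of _ "v _"] r)
    finally show ?thesis by (simp add: measure_le_0_iff)
  qed
  \<comment> \<open>For \<open>\<epsilon> < 1\<close> the whole window lies above \<open>r\<close>;
    its probability is 0 and \<open>elog\<close> returns \<open>-\<infinity>\<close>.\<close>
  have cr: "cramer_rate M \<omega> v x = \<infinity>" if x: "x \<ge> r + 1" for x
  proof -
    let ?f = "\<lambda>\<epsilon> n. elog (prob {w \<in> space M. (\<Sum>i=1..n. \<omega> (v i) w) / real n \<in> {x - \<epsilon><..<x + \<epsilon>}})
        / ereal (real n)"
    have "lim (?f \<epsilon>) = -\<infinity>" if "\<epsilon> \<in> {0<..<1}" for \<epsilon>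
    proof (rule limI, rule tendsto_eventually)
      show "\<forall>\<^sub>F n in sequentially. ?f \<epsilon> n = -\<infinity>"
        using eventually_ge_at_top[of 1] by eventually_elim (use that x 0 in \<open>simp add: elog_def\<close>)
    qed
    moreover have "\<forall>\<^sub>F \<epsilon>::real in at_right 0. \<epsilon> \<in> {0<..<1}" by (rule eventually_at_right_real) simp
    ultimately have "\<forall>\<^sub>F \<epsilon> in at_right 0. lim (?f \<epsilon>) = -\<infinity>" by (auto elim: eventually_mono)
    then have "Lim (at_right 0) (\<lambda>\<epsilon>. lim (?f \<epsilon>)) = -\<infinity>"
      by (intro tendsto_Lim tendsto_eventually) auto
    then show ?thesis by (simp add: cramer_rate_def)
  qed
  have "\<forall>\<^sub>F x in at_top. cramer_rate M \<omega> v x / ereal x = \<infinity>"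
    using eventually_ge_at_top[of "r + 1"] eventually_gt_at_top[of 0]
    by eventually_elim (simp add: cr)
  then show ?thesis unfolding alpha_inf_def by (intro tendsto_Lim tendsto_eventually) auto
qed

end

section \<open>From one-sided tails of the walk to the Cramer rate and its slope\<close>

context unbounded_weights
begin

lemma walk_rate:
  assumes "inj_on v {1..}"
  shows "(\<lambda>n. ln (prob {w \<in> space M. (\<Sum>j=1..n. \<omega> (v j) w) \<ge> real n * x}) / real n)
    \<longlonglongrightarrow> - J (axis i 1) x"
proof -
  have "(\<lambda>n. - (tail_rate (floor_pt (real n *\<^sub>R axis i 1)) (real n * x) / real n)) \<longlonglongrightarrow> - J (axis i 1) x"
    by (intro tendsto_minus filterlim_compose[OF tendsto_J[OF axis_1_nonneg axis_1_neq_0] filterlim_real_sequentially])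
  moreover have "prob {w \<in> space M. (\<Sum>j=1..n. \<omega> (v j) w) \<ge> real n * x} = tail (axis i n) (real n * x)" for n
    by (intro walk_tail inj_on_subset[OF assms]) auto
  ultimately show ?thesis by (simp add: floor_pt_axis tail_rate_def)
qed

text \<open>Chernoff's bound. Its linear growth is what the exponential moment contributes: the rate
  cannot stay constant.\<close>

lemma J_axis_ge:
  assumes xi: "\<xi> > 0" and int: "integrable M (\<lambda>w. exp (\<xi> * \<omega> 0 w))"
  shows "\<xi> * x - ln (expectation (\<lambda>w. exp (\<xi> * \<omega> 0 w))) \<le> J (axis i 1) x"
proof -
  let ?m = "expectation (\<lambda>w. exp (\<xi> * \<omega> 0 w))"
  have inj: "inj_on (axis i :: nat \<Rightarrow> nat ^ 'd) S" for S by (auto simp: inj_on_def axis_eq_axis)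
  have q0: "0 < prob {w \<in> space M. (\<Sum>j=1..n. \<omega> (axis i j) w) \<ge> r}" if "n \<ge> 1" for n r
  proof -
    have "axis i n \<noteq> (0 :: nat ^ 'd)" using that by (auto simp: axis_def vec_eq_iff)
    then show ?thesis unfolding walk_tail[OF inj, where i = i] by (rule tail_pos)
  qed
  have le: "prob {w \<in> space M. (\<Sum>j=1..n. \<omega> (axis i j) w) \<ge> r} \<le> ?m ^ n / exp (\<xi> * r)" for n r
  proof -
    have "prob {w \<in> space M. (\<Sum>j=1..n. \<omega> (axis i j) w) \<ge> r}
        = prob {w \<in> space M. exp (\<xi> * r) \<le> exp (\<xi> * (\<Sum>j=1..n. \<omega> (axis i j) w))}"
      using xi by simp
    also have "\<dots> \<le> expectation (\<lambda>w. exp (\<xi> * (\<Sum>j=1..n. \<omega> (axis i j) w))) / exp (\<xi> * r)"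
      by (rule integral_Markov_inequality_measure[OF expectation_exp_walk(1)[OF inj int], where A = "{}"]) auto
    finally show ?thesis unfolding expectation_exp_walk(2)[OF inj int] .
  qed
  have m: "?m > 0"
  proof -
    have "0 < ?m ^ 1 / exp (\<xi> * 0)" using q0[of 1 0] le[of 0 1] by linarith
    then show ?thesis by simp
  qed
  have "- J (axis i 1) x \<le> ln ?m - \<xi> * x"
  proof (rule tendsto_upperbound[OF walk_rate[OF inj, of x i]])
    show "\<forall>\<^sub>F n in sequentially.
        ln (prob {w \<in> space M. (\<Sum>j=1..n. \<omega> (axis i j) w) \<ge> real n * x}) / real n \<le> ln ?m - \<xi> * x"
      using eventually_ge_at_top[of 1]
    proof eventually_elim
      case (elim n)
      have "ln (prob {w \<in> space M. (\<Sum>j=1..n. \<omega> (axis i j) w) \<ge> real n * x})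
          \<le> ln (?m ^ n / exp (\<xi> * (real n * x)))"
        by (intro ln_mono le q0 elim)
      also have "\<dots> = real n * (ln ?m - \<xi> * x)"
        using m by (simp add: ln_div ln_realpow algebra_simps)
      finally show ?case using elim by (simp add: pos_divide_le_eq mult.commute)
    qed
  qed simp
  then show ?thesis by simp
qed

text \<open>A convex function that has risen above its value at 0 at a positive point is strictly
  increasing from there on; Chernoff's bound supplies such a point.\<close>

lemma J_axis_strict_mono:
  assumes xi: "\<xi> > 0" and int: "integrable M (\<lambda>w. exp (\<xi> * \<omega> 0 w))"
  obtains x1 where "\<And>x y. x1 \<le> x \<Longrightarrow> x < y \<Longrightarrow> J (axis i 1) x < J (axis i 1) y"
proof -
  let ?I = "J (axis i 1)"
  let ?K = "ln (expectation (\<lambda>w. exp (\<xi> * \<omega> 0 w)))"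
  \<comment> \<open>At this level the Chernoff bound is at least \<open>?I 0 + 1\<close>; the
    maximum with 1 keeps the level positive.\<close>
  define x1 where "x1 = max 1 ((?I 0 + ?K + 1) / \<xi>)"
  have "(?I 0 + ?K + 1) / \<xi> \<le> x1" by (simp add: x1_def)
  then have "?I 0 + ?K + 1 \<le> \<xi> * x1" using xi by (simp add: pos_divide_le_eq mult.commute)
  then have x1: "?I 0 < ?I x1" "0 < x1" using J_axis_ge[OF xi int, of x1 i] by (auto simp: x1_def)
  show ?thesis
  proof (rule that[of x1])
    fix x y assume xy: "x1 \<le> x" "x < y"
    then have y: "y > 0" "x > 0" using x1 by auto
    have "?I ((1 - x / y) *\<^sub>R 0 + (x / y) *\<^sub>R y) \<le> (1 - x / y) * ?I 0 + x / y * ?I y"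
      using xy y by (intro convex_onD[OF J_convex[OF axis_1_nonneg axis_1_neq_0]]) auto
    then have c: "?I x - ?I 0 \<le> x / y * (?I y - ?I 0)" using y by (simp add: algebra_simps)
    have "?I x1 \<le> ?I x" using xy by (intro J_mono axis_1_nonneg axis_1_neq_0)
    then have "0 < ?I x - ?I 0" using x1 by simp
    with c have "0 < x / y * (?I y - ?I 0)" by linarith
    then have "0 < ?I y - ?I 0" using y by (simp add: zero_less_divide_iff zero_less_mult_iff)
    then have "x / y * (?I y - ?I 0) < 1 * (?I y - ?I 0)"
      using xy y by (intro mult_strict_right_mono) auto
    with c show "?I x < ?I y" by simp
  qed
qed

text \<open>The right tail is steepest at its left end, so it alone determines the rate of an
  interval on which the rate increases; no separate subadditivity argument for intervals
  is needed.\<close>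

lemma interval_rate:
  assumes inj: "inj_on v {1..}" and ab: "a < b"
    and incr: "\<And>x y. a \<le> x \<Longrightarrow> x < y \<Longrightarrow> J (axis i 1) x < J (axis i 1) y"
  shows "(\<lambda>n. elog (prob {w \<in> space M. (\<Sum>j=1..n. \<omega> (v j) w) / real n \<in> {a<..<b}}) / ereal (real n))
    \<longlonglongrightarrow> ereal (- J (axis i 1) a)"
proof -
  let ?I = "J (axis i 1)"
  define p where "p n = prob {w \<in> space M. (\<Sum>j=1..n. \<omega> (v j) w) / real n \<in> {a<..<b}}" for n
  define q where "q n x = prob {w \<in> space M. (\<Sum>j=1..n. \<omega> (v j) w) \<ge> real n * x}" for n x
  have q: "(\<lambda>n. ln (q n x) / real n) \<longlonglongrightarrow> - ?I x" for x
    unfolding q_def by (rule walk_rate[OF inj])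
  have q0: "q n x > 0" if "n \<ge> 1" for n x
  proof -
    have "axis i n \<noteq> (0 :: nat ^ 'd)" using that by (auto simp: axis_def vec_eq_iff)
    moreover have "q n x = tail (axis i n) (real n * x)"
      unfolding q_def by (intro walk_tail inj_on_subset[OF inj]) auto
    ultimately show ?thesis using tail_pos by simp
  qed
  have pq: "p n \<le> q n a" if "n \<ge> 1" for n
    unfolding p_def q_def using that
    by (intro finite_measure_mono) (auto simp: field_simps)
  have qp: "q n c - q n b \<le> p n" if "n \<ge> 1" "a < c" for n c
  proof -
    have "q n c \<le> prob ({w \<in> space M. (\<Sum>j=1..n. \<omega> (v j) w) / real n \<in> {a<..<b}}
        \<union> {w \<in> space M. (\<Sum>j=1..n. \<omega> (v j) w) \<ge> real n * b})"
      unfolding q_def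
    proof (rule finite_measure_mono)
      show "{w \<in> space M. (\<Sum>j=1..n. \<omega> (v j) w) \<ge> real n * c}
        \<subseteq> {w \<in> space M. (\<Sum>j=1..n. \<omega> (v j) w) / real n \<in> {a<..<b}}
          \<union> {w \<in> space M. (\<Sum>j=1..n. \<omega> (v j) w) \<ge> real n * b}"
      proof clarsimp
        fix w assume "real n * c \<le> (\<Sum>j=Suc 0..n. \<omega> (v j) w)" "\<not> real n * b \<le> (\<Sum>j=Suc 0..n. \<omega> (v j) w)"
        moreover have "real n * a < real n * c" using that by simp
        ultimately have "real n * a < (\<Sum>j=Suc 0..n. \<omega> (v j) w)" "(\<Sum>j=Suc 0..n. \<omega> (v j) w) < real n * b"
          by linarith+
        then show "a < (\<Sum>j=Suc 0..n. \<omega> (v j) w) / real n \<and> (\<Sum>j=Suc 0..n. \<omega> (v j) w) / real n < b"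
          using that by (simp add: pos_less_divide_eq pos_divide_less_eq mult.commute)
      qed
    qed measurable
    also have "\<dots> \<le> p n + q n b"
      unfolding p_def q_def by (rule measure_Un_le) measurable
    finally show ?thesis by simp
  qed
  \<comment> \<open>The tail at \<open>b\<close> has a strictly larger rate than the tail at
    \<open>c\<close>, so eventually it is at most half as large, and \<open>qp\<close> leaves the
    other half for the window.\<close>
  have half: "\<forall>\<^sub>F n in sequentially. q n c / 2 \<le> p n" if c: "a < c" "c < b" for c
  proof -
    define \<delta> where "\<delta> = ?I b - ?I c"
    have \<delta>: "\<delta> > 0" using incr[of c b] c by (simp add: \<delta>_def)
    have "(\<lambda>n. ln (q n b) / real n - ln (q n c) / real n) \<longlonglongrightarrow> - ?I b - - ?I c"
      by (intro tendsto_diff q)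
    then have "\<forall>\<^sub>F n in sequentially. ln (q n b) / real n - ln (q n c) / real n < - (\<delta> / 2)"
      by (rule order_tendstoD) (use \<delta> \<delta>_def in linarith)
    \<comment> \<open>For such \<open>n\<close>, \<open>real n * \<delta> / 2\<close> is at least
      \<open>ln 2\<close>, the price of the factor 2.\<close>
    moreover have "\<forall>\<^sub>F n in sequentially. real n \<ge> 2 * ln 2 / \<delta>"
      using filterlim_real_sequentially by (auto simp: filterlim_at_top)
    ultimately show ?thesis using eventually_ge_at_top[of 1]
    proof eventually_elim
      case (elim n)
      from elim(1,3) have "ln (q n b) - ln (q n c) < real n * - (\<delta> / 2)"
        by (simp add: diff_divide_distrib[symmetric] pos_divide_less_eq mult.commute)
      also have "real n * - (\<delta> / 2) \<le> - ln 2"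
        using elim(2) \<delta> by (simp add: pos_divide_le_eq)
      finally have "ln (q n b) \<le> ln (q n c / 2)"
        using q0[OF elim(3), of c] by (simp add: ln_div)
      then have "q n b \<le> q n c / 2"
        using q0[OF elim(3)] by (subst (asm) ln_le_cancel_iff) auto
      with qp[OF elim(3) c(1)] show ?case by simp
    qed
  qed
  have ppos: "\<forall>\<^sub>F n in sequentially. p n > 0"
  proof -
    have "\<forall>\<^sub>F n in sequentially. q n ((a + b) / 2) / 2 \<le> p n" using ab by (intro half) auto
    then show ?thesis using eventually_ge_at_top[of 1]
    proof eventually_elim
      case (elim n)
      then show ?case using q0[OF elim(2), of "(a + b) / 2"] by linarith
    qed
  qed
  have "(\<lambda>n. ln (p n) / real n) \<longlonglongrightarrow> - ?I a"
  proof (rule order_tendstoI)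
    fix e assume "- ?I a < e"
    with q[of a] have "\<forall>\<^sub>F n in sequentially. ln (q n a) / real n < e" by (rule order_tendstoD)
    then show "\<forall>\<^sub>F n in sequentially. ln (p n) / real n < e"
      using ppos eventually_ge_at_top[of 1]
    proof eventually_elim
      case (elim n)
      have "ln (p n) / real n \<le> ln (q n a) / real n"
        using elim pq by (intro divide_right_mono ln_mono) auto
      with elim show ?case by simp
    qed
  next
    fix e assume e: "e < - ?I a"
    \<comment> \<open>The lower bound is available for every \<open>c\<close> in the window;
      continuity of the rate lets \<open>c\<close> decrease to \<open>a\<close>.\<close>
    have "((\<lambda>c. - ?I c) \<longlongrightarrow> - ?I a) (at_right a)"
      by (intro tendsto_minus tendsto_J_right axis_1_nonneg axis_1_neq_0 tendsto_ident_at)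
    then have "\<forall>\<^sub>F c in at_right a. e < - ?I c" using e by (rule order_tendstoD)
    moreover have "\<forall>\<^sub>F c in at_right a. c \<in> {a<..<b}" using ab by (rule eventually_at_right_real)
    ultimately obtain c where c: "e < - ?I c" "a < c" "c < b"
      using eventually_happens[OF eventually_conj] by fastforce
    have "(\<lambda>n. ln (q n c) / real n - ln 2 / real n) \<longlonglongrightarrow> - ?I c - 0"
      by (intro tendsto_diff q tendsto_divide_0[OF tendsto_const] filterlim_at_top_imp_at_infinity
          filterlim_real_sequentially)
    then have "\<forall>\<^sub>F n in sequentially. e < ln (q n c) / real n - ln 2 / real n"
      by (rule order_tendstoD) (use c in simp)
    then show "\<forall>\<^sub>F n in sequentially. e < ln (p n) / real n"
      using half[OF c(2,3)] eventually_ge_at_top[of 1]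
    proof eventually_elim
      case (elim n)
      have "ln (q n c / 2) / real n \<le> ln (p n) / real n"
        using elim q0[OF elim(3), of c] by (intro divide_right_mono ln_mono) auto
      then show ?case
        using elim q0[OF elim(3), of c] by (simp add: ln_div diff_divide_distrib)
    qed
  qed
  then have "(\<lambda>n. ereal (ln (p n) / real n)) \<longlonglongrightarrow> ereal (- ?I a)" by simp
  then show ?thesis
  proof (rule Lim_transform_eventually)
    show "\<forall>\<^sub>F n in sequentially. ereal (ln (p n) / real n)
        = elog (prob {w \<in> space M. (\<Sum>j=1..n. \<omega> (v j) w) / real n \<in> {a<..<b}}) / ereal (real n)"
      using ppos eventually_ge_at_top[of 1]
      unfolding p_def[symmetric] by eventually_elim (simp add: elog_def)
  qed
qed

text \<open>For small \<open>\<epsilon>\<close> the window around \<open>x\<close> stays where the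
  rate increases, so its rate is the value at the left end \<open>x - \<epsilon>\<close>; continuity
  removes \<open>\<epsilon>\<close>.\<close>

lemma cramer_rate_eq_J:
  assumes inj: "inj_on v {1..}" and x: "x1 < x"
    and incr: "\<And>x y. x1 \<le> x \<Longrightarrow> x < y \<Longrightarrow> J (axis i 1) x < J (axis i 1) y"
  shows "cramer_rate M \<omega> v x = ereal (J (axis i 1) x)"
proof -
  let ?f = "\<lambda>\<epsilon> n. elog (prob {w \<in> space M. (\<Sum>i=1..n. \<omega> (v i) w) / real n \<in> {x - \<epsilon><..<x + \<epsilon>}})
      / ereal (real n)"
  have "lim (?f \<epsilon>) = ereal (- J (axis i 1) (x - \<epsilon>))" if "\<epsilon> \<in> {0<..<x - x1}" for \<epsilon>
    using that incr by (intro limI interval_rate[OF inj]) auto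
  moreover have "\<forall>\<^sub>F \<epsilon> in at_right 0. \<epsilon> \<in> {0<..<x - x1}"
    using x by (intro eventually_at_right_real) simp
  ultimately have ev: "\<forall>\<^sub>F \<epsilon> in at_right 0. ereal (- J (axis i 1) (x - \<epsilon>)) = lim (?f \<epsilon>)"
    by (auto elim: eventually_mono)
  have "((\<lambda>\<epsilon>. ereal (- J (axis i 1) (x - \<epsilon>))) \<longlongrightarrow> ereal (- J (axis i 1) (x - 0))) (at_right 0)"
    by (intro tendsto_ereal tendsto_minus tendsto_J_right axis_1_nonneg axis_1_neq_0 tendsto_diff
        tendsto_const tendsto_ident_at)
  then have "((\<lambda>\<epsilon>. lim (?f \<epsilon>)) \<longlongrightarrow> ereal (- J (axis i 1) (x - 0))) (at_right 0)"
    using ev by (rule Lim_transform_eventually)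
  then have "Lim (at_right 0) (\<lambda>\<epsilon>. lim (?f \<epsilon>)) = ereal (- J (axis i 1) (x - 0))"
    by (intro tendsto_Lim) auto
  then show ?thesis by (simp add: cramer_rate_def)
qed

text \<open>The chord slopes of a convex function from its value at 0 increase, so their limit
  \<open>A\<close> is also their supremum. This gives the linear upper bound along with the
  asymptotic slope; finiteness of \<open>alpha_inf\<close> rules out unbounded slopes.\<close>

lemma alpha_inf_J:
  assumes inj: "inj_on v {1..}"
    and xi: "\<xi> > 0" and int: "integrable M (\<lambda>w. exp (\<xi> * \<omega> 0 w))"
    and fin: "alpha_inf M \<omega> v < \<infinity>"
  obtains A where "alpha_inf M \<omega> v = ereal A" "0 \<le> A"
    "\<And>i x. x \<ge> 0 \<Longrightarrow> J (axis i 1) x \<le> J (axis i 1) 0 + A * x"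
    "\<And>i. ((\<lambda>x. J (axis i 1) x / x) \<longlongrightarrow> A) at_top"
proof -
  have main: "\<exists>A. alpha_inf M \<omega> v = ereal A \<and> 0 \<le> A
      \<and> (\<forall>x\<ge>0. J (axis i 1) x \<le> J (axis i 1) 0 + A * x)
      \<and> ((\<lambda>x. J (axis i 1) x / x) \<longlongrightarrow> A) at_top" for i
  proof -
    let ?I = "J (axis i 1)"
    define g where "g x = (?I x - ?I 0) / x" for x
    have I0: "?I 0 \<ge> 0" by (intro J_nonneg axis_1_nonneg axis_1_neq_0)
    have gmono: "g x \<le> g y" if "0 < x" "x \<le> y" for x y
    proof -
      have "?I ((1 - x / y) *\<^sub>R 0 + (x / y) *\<^sub>R y) \<le> (1 - x / y) * ?I 0 + x / y * ?I y"
        using that by (intro convex_onD[OF J_convex[OF axis_1_nonneg axis_1_neq_0]]) auto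
      then have "?I x - ?I 0 \<le> x / y * (?I y - ?I 0)" using that by (simp add: algebra_simps)
      then show ?thesis using that by (simp add: g_def field_simps)
    qed
    obtain x1 where x1: "\<And>x y. x1 \<le> x \<Longrightarrow> x < y \<Longrightarrow> ?I x < ?I y"
      using J_axis_strict_mono[OF xi int] by blast
    have ev: "\<forall>\<^sub>F x in at_top. ereal (?I x / x) = cramer_rate M \<omega> v x / ereal x"
      using eventually_gt_at_top[of x1] eventually_gt_at_top[of 0]
      by eventually_elim (simp add: cramer_rate_eq_J[OF inj _ x1])
    have bdd: "\<exists>K. \<forall>x>0. g x \<le> K"
    proof (rule ccontr)
      assume unb: "\<not> ?thesis"
      have "filterlim (\<lambda>x. ?I x / x) at_top at_top"
        unfolding filterlim_at_top
      proof
        fix Z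
        obtain y where y: "y > 0" "g y > Z" using unb by (auto simp: not_le)
        show "\<forall>\<^sub>F x in at_top. Z \<le> ?I x / x"
          using eventually_ge_at_top[of y]
        proof eventually_elim
          case (elim x)
          have "Z \<le> g x" using y gmono[OF y(1) elim] by simp
          also have "\<dots> \<le> ?I x / x" using I0 elim y by (simp add: g_def divide_right_mono)
          finally show ?case .
        qed
      qed
      then have "((\<lambda>x. ereal (?I x / x)) \<longlongrightarrow> \<infinity>) at_top"
        by (simp add: tendsto_PInfty_eq_at_top)
      then have "((\<lambda>x. cramer_rate M \<omega> v x / ereal x) \<longlongrightarrow> \<infinity>) at_top"
        using ev by (rule Lim_transform_eventually)
      then have "alpha_inf M \<omega> v = \<infinity>" unfolding alpha_inf_def by (intro tendsto_Lim) auto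
      with fin show False by simp
    qed
    define A where "A = Sup (g ` {0<..})"
    have bd: "bdd_above (g ` {0<..})" using bdd by (auto simp: bdd_above_def)
    have gA: "g x \<le> A" if "x > 0" for x
      unfolding A_def using that by (intro cSup_upper bd) auto
    have "(g \<longlongrightarrow> A) at_top"
    proof (rule order_tendstoI)
      fix e assume "e < A"
      then obtain y where y: "y > 0" "e < g y"
        unfolding A_def by (subst (asm) less_cSup_iff[OF _ bd]) auto
      show "\<forall>\<^sub>F x in at_top. e < g x"
        using eventually_ge_at_top[of y] by eventually_elim (use y gmono in force)
    next
      fix e assume "A < e"
      show "\<forall>\<^sub>F x in at_top. g x < e"
        using eventually_gt_at_top[of 0] by eventually_elim (use \<open>A < e\<close> gA in force)
    qed
    moreover have "((\<lambda>x. ?I 0 / x) \<longlongrightarrow> 0) at_top"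
      by (intro tendsto_divide_0[OF tendsto_const] filterlim_at_top_imp_at_infinity filterlim_ident)
    ultimately have "((\<lambda>x. g x + ?I 0 / x) \<longlongrightarrow> A + 0) at_top" by (rule tendsto_add)
    then have lim: "((\<lambda>x. ?I x / x) \<longlongrightarrow> A) at_top"
      by (simp add: g_def diff_divide_distrib)
    then have "((\<lambda>x. ereal (?I x / x)) \<longlongrightarrow> ereal A) at_top" by simp
    then have "((\<lambda>x. cramer_rate M \<omega> v x / ereal x) \<longlongrightarrow> ereal A) at_top"
      using ev by (rule Lim_transform_eventually)
    then have "alpha_inf M \<omega> v = ereal A" unfolding alpha_inf_def by (intro tendsto_Lim) auto
    moreover have "0 \<le> g 1"
      using J_mono[OF axis_1_nonneg axis_1_neq_0, of 0 1 i] by (simp add: g_def)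
    then have "0 \<le> A" using gA[of 1] by simp
    moreover have "?I x \<le> ?I 0 + A * x" if "x \<ge> 0" for x
    proof (cases "x = 0")
      case False
      then show ?thesis using gA[of x] that by (simp add: g_def field_simps)
    qed simp
    ultimately show ?thesis using lim by blast
  qed
  \<comment> \<open>\<open>alpha_inf\<close> does not refer to a direction, so the same
    \<open>A\<close> serves every axis.\<close>
  obtain A where A: "alpha_inf M \<omega> v = ereal A" using main by blast
  have "0 \<le> A \<and> (\<forall>x\<ge>0. J (axis i 1) x \<le> J (axis i 1) 0 + A * x)
      \<and> ((\<lambda>x. J (axis i 1) x / x) \<longlongrightarrow> A) at_top" for i
    using main[of i] A by auto
  then show ?thesis using that[OF A] by blast
qed

end

section \<open>Continuity at the origin\<close>

context unbounded_weights
begin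

text \<open>A real-valued form of the rate with the origin filled in, so that the limits can be
  taken in the reals; \<open>max r 0\<close> merges the two cases of the sign of
  \<open>r\<close>.\<close>

definition J_ext :: "real \<Rightarrow> real ^ 'd \<Rightarrow> real \<Rightarrow> real" where
  "J_ext A u r = (if u = 0 then A * max r 0 else J u r)"

text \<open>A positive coordinate of \<open>u\<close> gives a multiple of a unit vector below
  \<open>u\<close>, where homogeneity and the linear bound on the axis apply; the other steps are
  appended. The factor \<open>u $ i\<close> cancels in the slope term, so the bound is uniform up to
  the origin.\<close>

lemma J_ext_le:
  assumes A: "0 \<le> A" "\<And>i x. x \<ge> 0 \<Longrightarrow> J (axis i 1) x \<le> J (axis i 1) 0 + A * x"
    and u: "0 \<le> u"
  shows "J_ext A u r \<le> A * max r 0 + site_cost * coord_sum u"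
proof (cases "u = 0")
  case False
  with u obtain i where i: "u $ i > 0" using nonneg_vec_neq_0 by blast
  let ?e = "axis i 1 :: real ^ 'd"
  have ui: "u $ i *\<^sub>R ?e = axis i (u $ i)" by (simp add: axis_def vec_eq_iff)
  have "J u r \<le> J (u $ i *\<^sub>R ?e) r + site_cost * (coord_sum u - coord_sum (u $ i *\<^sub>R ?e))"
    unfolding ui by (intro J_le) (use u i in \<open>auto simp: less_eq_vec_def axis_def vec_eq_iff\<close>)
  also have "J (u $ i *\<^sub>R ?e) r = u $ i * J ?e (r / u $ i)"
    by (intro J_scale' axis_1_nonneg axis_1_neq_0 i)
  also have "J ?e (r / u $ i) \<le> J ?e (max (r / u $ i) 0)"
    by (intro J_mono axis_1_nonneg axis_1_neq_0) simp
  also have "\<dots> \<le> J ?e 0 + A * max (r / u $ i) 0"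
    by (intro A) simp
  also have "J ?e 0 \<le> site_cost"
    using J_0_le[OF axis_1_nonneg axis_1_neq_0, of i] by simp
  also have "max (r / u $ i) 0 = max r 0 / u $ i"
    using i by (simp add: max_def field_simps)
  finally have "J u r \<le> u $ i * (site_cost + A * (max r 0 / u $ i)) + site_cost * (coord_sum u - u $ i)"
    using i by (simp add: coord_sum_scaleR)
  also have "\<dots> = A * max r 0 + site_cost * coord_sum u"
    using i by (simp add: field_simps)
  finally show ?thesis using False by (simp add: J_ext_def)
qed (simp add: J_ext_def)

lemma J_ext_nonneg: "0 \<le> A \<Longrightarrow> 0 \<le> u \<Longrightarrow> 0 \<le> J_ext A u r"
  by (simp add: J_ext_def J_nonneg)

text \<open>Collapsing everything onto one axis compares \<open>J\<close> with a rescaled walk rate.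
  A slope \<open>b < A\<close> is taken because \<open>J (axis i 1) x / x\<close> only tends to
  \<open>A\<close>: the deficit below \<open>A * x\<close> may be unbounded, whereas the deficit
  below \<open>b * x\<close> is bounded.\<close>

lemma J_ext_ge:
  assumes A: "\<And>i. ((\<lambda>x. J (axis i 1) x / x) \<longlongrightarrow> A) at_top" and b: "0 \<le> b" "b < A"
  shows "\<exists>K. \<forall>u r. 0 \<le> u \<longrightarrow> b * r - K * coord_sum u \<le> J_ext A u r"
proof -
  obtain k :: 'd where True by blast
  let ?e = "axis k 1 :: real ^ 'd"
  have "\<forall>\<^sub>F x in at_top. b < J ?e x / x" using A b(2) by (rule order_tendstoD)
  then obtain X where X: "\<And>x. x \<ge> X \<Longrightarrow> b < J ?e x / x"
    by (auto simp: eventually_at_top_linorder)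
  define X' where "X' = max X 1"
  have lin: "b * x - b * X' \<le> J ?e x" for x
  proof (cases "x \<ge> X'")
    case True
    then have "b < J ?e x / x" "x > 0" using X by (auto simp: X'_def)
    then have "b * x < J ?e x" by (simp add: field_simps)
    moreover have "0 \<le> b * X'" using b by (simp add: X'_def)
    ultimately show ?thesis by simp
  next
    case False
    then have "b * x \<le> b * X'" using b by (intro mult_left_mono) auto
    moreover have "0 \<le> J ?e x" by (intro J_nonneg axis_1_nonneg axis_1_neq_0)
    ultimately show ?thesis by simp
  qed
  \<comment> \<open>The three terms pay for the shift of the level by the entropy, the constant in
    \<open>lin\<close>, and the entropy itself.\<close>
  define K where "K = b * real CARD('d) + b * X' + real CARD('d)"
  have "b * r - K * coord_sum u \<le> J_ext A u r" if u: "0 \<le> u" for u r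
  proof (cases "u = 0")
    case True
    have "b * r \<le> b * max r 0" using b by (intro mult_left_mono) auto
    also have "\<dots> \<le> A * max r 0" using b by (intro mult_right_mono) auto
    finally show ?thesis using True by (simp add: J_ext_def)
  next
    case False
    define s where "s = coord_sum u"
    have s: "s > 0" using coord_sum_pos[OF u False] by (simp add: s_def)
    let ?B = "UNIV - {k}"
    have "collapse ?B k u = s *\<^sub>R ?e"
    proof -
      have "u $ k + (\<Sum>j\<in>?B. u $ j) = s"
        unfolding s_def coord_sum_def by (rule sum.remove[symmetric]) auto
      then show ?thesis by (auto simp: collapse_def vec_eq_iff axis_def)
    qed
    \<comment> \<open>At \<open>t = 1\<close> the logarithmic term vanishes and the cost is
      \<open>s * real CARD('d)\<close>, which is small near the origin.\<close>
    then have "J (s *\<^sub>R ?e) (r - s * real CARD('d)) - s * real CARD('d) \<le> J u r"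
      using J_collapse[of k ?B 1 u r] u False by (simp add: s_def)
    moreover have "J (s *\<^sub>R ?e) (r - s * real CARD('d)) = s * J ?e ((r - s * real CARD('d)) / s)"
      by (intro J_scale' axis_1_nonneg axis_1_neq_0 s)
    moreover have "s * (b * ((r - s * real CARD('d)) / s) - b * X') \<le> s * J ?e ((r - s * real CARD('d)) / s)"
      using s by (intro mult_left_mono lin) auto
    moreover have "s * (b * ((r - s * real CARD('d)) / s) - b * X') - s * real CARD('d) = b * r - K * s"
      using s by (simp add: K_def field_simps)
    ultimately show ?thesis using False by (simp add: J_ext_def s_def)
  qed
  then show ?thesis by blast
qed

lemma tendsto_J_ext:
  fixes u :: "'x \<Rightarrow> real ^ 'd" and r :: "'x \<Rightarrow> real"
  assumes A: "0 \<le> A" "\<And>i x. x \<ge> 0 \<Longrightarrow> J (axis i 1) x \<le> J (axis i 1) 0 + A * x"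
      "\<And>i. ((\<lambda>x. J (axis i 1) x / x) \<longlongrightarrow> A) at_top"
    and u0: "0 \<le> u0" and u: "(u \<longlongrightarrow> u0) F" and r: "(r \<longlongrightarrow> r0) F"
    and nonneg: "\<forall>\<^sub>F x in F. 0 \<le> u x"
  shows "((\<lambda>x. J_ext A (u x) (r x)) \<longlongrightarrow> J_ext A u0 r0) F"
proof (cases "u0 = 0")
  case False
  obtain k where "u0 $ k > 0" using nonneg_vec_neq_0[OF u0 False] .
  with tendsto_vec_nth[OF u] have "\<forall>\<^sub>F x in F. u x $ k > 0" by (rule order_tendstoD)
  then have "\<forall>\<^sub>F x in F. J (u x) (r x) = J_ext A (u x) (r x)"
    by eventually_elim (auto simp: J_ext_def)
  with tendsto_J_pair[OF u0 False u r nonneg] have "((\<lambda>x. J_ext A (u x) (r x)) \<longlongrightarrow> J u0 r0) F"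
    by (rule Lim_transform_eventually)
  then show ?thesis using False by (simp add: J_ext_def)
next
  case True
  have us: "((\<lambda>x. coord_sum (u x)) \<longlongrightarrow> 0) F"
  proof -
    have "((\<lambda>x. \<Sum>i\<in>UNIV. u x $ i) \<longlongrightarrow> (\<Sum>i\<in>UNIV. u0 $ i)) F"
      by (intro tendsto_sum tendsto_vec_nth u)
    then show ?thesis by (simp add: coord_sum_def True)
  qed
  have "((\<lambda>x. J_ext A (u x) (r x)) \<longlongrightarrow> A * max r0 0) F"
  proof (rule order_tendstoI)
    fix e assume "A * max r0 0 < e"
    moreover have "((\<lambda>x. A * max (r x) 0 + site_cost * coord_sum (u x)) \<longlongrightarrow> A * max r0 0 + site_cost * 0) F"
      by (intro tendsto_intros r us)
    ultimately have "\<forall>\<^sub>F x in F. A * max (r x) 0 + site_cost * coord_sum (u x) < e"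
      by (intro order_tendstoD(2)) auto
    with nonneg show "\<forall>\<^sub>F x in F. J_ext A (u x) (r x) < e"
      by eventually_elim (use J_ext_le[OF A(1,2)] in \<open>blast intro: le_less_trans\<close>)
  next
    fix e assume e: "e < A * max r0 0"
    show "\<forall>\<^sub>F x in F. e < J_ext A (u x) (r x)"
    \<comment> \<open>For negative \<open>e\<close> nonnegativity suffices. Otherwise
      \<open>r0 > 0\<close>, and there is room for a slope \<open>b\<close> between
      \<open>e / r0\<close> and \<open>A\<close>.\<close>
    proof (cases "e < 0")
      case True
      show ?thesis using nonneg
        by eventually_elim (use True J_ext_nonneg[OF A(1)] in \<open>blast intro: less_le_trans\<close>)
    next
      case False
      with e A(1) have r0: "r0 > 0" "e < A * r0" "A > 0"
        by (auto simp: max_def zero_less_mult_iff less_le split: if_splits)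
      then have "max 0 (e / r0) < A" by (simp add: pos_divide_less_eq)
      then obtain b where b: "max 0 (e / r0) < b" "b < A" using dense by blast
      then have b': "0 \<le> b" "e < b * r0" using r0 by (auto simp: pos_divide_less_eq)
      obtain K where K: "\<And>u r. 0 \<le> u \<Longrightarrow> b * r - K * coord_sum u \<le> J_ext A u r"
        using J_ext_ge[OF A(3) b'(1) b(2)] by blast
      have "((\<lambda>x. b * r x - K * coord_sum (u x)) \<longlongrightarrow> b * r0 - K * 0) F"
        by (intro tendsto_intros r us)
      then have "\<forall>\<^sub>F x in F. e < b * r x - K * coord_sum (u x)"
        using b' by (intro order_tendstoD(1)) auto
      with nonneg show ?thesis
        by eventually_elim (use K in \<open>blast intro: less_le_trans\<close>)
    qed
  qed
  then show ?thesis using True by (simp add: J_ext_def)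
qed

text \<open>Along integers the rounded points are eventually nonzero, so the tails are positive
  there and \<open>elog\<close> agrees with \<open>ln\<close>.\<close>

lemma tendsto_tail_exponent:
  assumes u: "0 \<le> u" "u \<noteq> 0"
  shows "tail_exponent M \<omega> u r \<longlonglongrightarrow> ereal (- J u r)"
proof -
  have "(\<lambda>n. - (tail_rate (floor_pt (real n *\<^sub>R u)) (real n * r) / real n)) \<longlonglongrightarrow> - J u r"
    by (intro tendsto_minus filterlim_compose[OF tendsto_J[OF u] filterlim_real_sequentially])
  then have "(\<lambda>n. ereal (- (tail_rate (floor_pt (real n *\<^sub>R u)) (real n * r) / real n)))
      \<longlonglongrightarrow> ereal (- J u r)" by simp
  moreover have "\<forall>\<^sub>F n in sequentially.
      ereal (- (tail_rate (floor_pt (real n *\<^sub>R u)) (real n * r) / real n)) = tail_exponent M \<omega> u r n"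
    using eventually_compose_filterlim[OF eventually_floor_pt_neq_0[OF u] filterlim_real_sequentially]
      eventually_ge_at_top[of 1]
  proof eventually_elim
    case (elim n)
    then have "tail (floor_pt (real n *\<^sub>R u)) (real n * r) > 0" by (intro tail_pos)
    then show ?case
      using elim by (simp add: tail_exponent_def tail_def[symmetric] elog_def tail_rate_def)
  qed
  ultimately show ?thesis by (rule Lim_transform_eventually)
qed

lemma J_rate_eq:
  assumes "0 \<le> u"
  shows "J_rate M \<omega> (ereal A) u r = ereal (J_ext A u r)"
proof (cases "u = 0")
  case False
  then have "lim (tail_exponent M \<omega> u r) = ereal (- J u r)"
    using assms by (intro limI tendsto_tail_exponent)
  with False show ?thesis by (simp add: J_rate_def J_ext_def)
qed (simp add: J_rate_def J_ext_def max_def)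

end

theorem theorem3p3:
  fixes M :: "'w measure"
    and \<omega> :: "nat ^ 'd \<Rightarrow> 'w \<Rightarrow> real"
    and v :: "nat \<Rightarrow> nat ^ 'd"
    and \<xi> :: real
  assumes dim: "CARD('d) \<ge> 2"
    and prob: "prob_space M"
    and indep: "prob_space.indep_vars M (\<lambda>_. borel) \<omega> UNIV"
    and ident: "\<forall>u. distr M borel (\<omega> u) = distr M borel (\<omega> 0)"
    and xi: "\<xi> > 0" "integrable M (\<lambda>w. exp (\<xi> * \<bar>\<omega> 0 w\<bar>))"
    and distinct_pts: "inj_on v {1..}"
    and alpha_fin: "alpha_inf M \<omega> v < \<infinity>"
  shows "(\<forall>u\<in>nonneg_orthant - {0}. \<forall>r. convergent (tail_exponent M \<omega> u r))
       \<and> (\<forall>u\<in>nonneg_orthant. \<forall>r. \<bar>J_rate M \<omega> (alpha_inf M \<omega> v) u r\<bar> \<noteq> \<infinity>)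
       \<and> continuous_on (nonneg_orthant \<times> UNIV)
           (\<lambda>(u, r). J_rate M \<omega> (alpha_inf M \<omega> v) u r)"
proof -
  interpret prob_space M by (rule prob)
  interpret iid_weights M \<omega> by unfold_locales (use indep ident in auto)
  interpret unbounded_weights M \<omega>
  proof unfold_locales
    fix r
    have "prob {w \<in> space M. \<omega> 0 w \<ge> r} \<noteq> 0" using alpha_inf_bounded[of r v] alpha_fin by auto
    then show "prob {w \<in> space M. \<omega> 0 w \<ge> r} > 0" by (simp add: less_le)
  qed
  have int: "integrable M (\<lambda>w. exp (\<xi> * \<omega> 0 w))"
  proof (rule Bochner_Integration.integrable_bound[OF xi(2)])
    show "AE w in M. norm (exp (\<xi> * \<omega> 0 w)) \<le> norm (exp (\<xi> * \<bar>\<omega> 0 w\<bar>))"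
      using xi(1) by (intro AE_I2) simp
  qed measurable
  obtain A where A: "alpha_inf M \<omega> v = ereal A" "0 \<le> A"
      "\<And>i x. x \<ge> 0 \<Longrightarrow> J (axis i 1) x \<le> J (axis i 1) 0 + A * x"
      "\<And>i. ((\<lambda>x. J (axis i 1) x / x) \<longlongrightarrow> A) at_top"
    using alpha_inf_J[OF distinct_pts xi(1) int alpha_fin] by blast
  have "\<forall>u\<in>nonneg_orthant - {0}. \<forall>r. convergent (tail_exponent M \<omega> u r)"
    by (auto simp: nonneg_orthant_iff intro!: convergentI tendsto_tail_exponent)
  moreover have "\<forall>u\<in>nonneg_orthant. \<forall>r. \<bar>J_rate M \<omega> (alpha_inf M \<omega> v) u r\<bar> \<noteq> \<infinity>"
    by (simp add: A(1) J_rate_eq nonneg_orthant_iff)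
  moreover have "continuous_on (nonneg_orthant \<times> UNIV)
      (\<lambda>(u, r). J_rate M \<omega> (alpha_inf M \<omega> v) u r)"
  proof -
    have "continuous_on (nonneg_orthant \<times> UNIV) (\<lambda>x. J_ext A (fst x) (snd x))"
      unfolding continuous_on_def
    proof
      fix x :: "(real ^ 'd) \<times> real" assume x: "x \<in> nonneg_orthant \<times> UNIV"
      let ?F = "at x within nonneg_orthant \<times> UNIV"
      show "((\<lambda>x. J_ext A (fst x) (snd x)) \<longlongrightarrow> J_ext A (fst x) (snd x)) ?F"
      proof (rule tendsto_J_ext[OF A(2,3,4)])
        show "\<forall>\<^sub>F y in ?F. 0 \<le> fst y"
          unfolding eventually_at_filter by (rule always_eventually) (auto simp: nonneg_orthant_iff)
      qed (use x in \<open>auto simp: nonneg_orthant_iff intro!: tendsto_intros\<close>)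
    qed
    then have "continuous_on (nonneg_orthant \<times> UNIV) (\<lambda>x. ereal (J_ext A (fst x) (snd x)))"
      by (rule continuous_on_ereal)
    then show ?thesis
      by (rule continuous_on_eq) (auto simp: A(1) J_rate_eq nonneg_orthant_iff)
  qed
  ultimately show ?thesis by blast
qed

end
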